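(* Let $f(\cdot;i):\mathbb{R}^d\to\mathbb{R}$, $i\in[n]$, be convex and $L$-smooth with a common constant $L>0$, and suppose $F=\frac1n\sum_{i=1}^n f(\cdot;i)$ is $\mu$-strongly convex for some $\mu\in(0,\infty)$. Let $w_*$ be the minimizer of $F$ and $\sigma^2:=\frac1n\sum_{i=1}^n\|\nabla f(w_*;i)\|^2$. Run the SMG algorithm for $T\ge1$ epochs with a fixed momentum parameter $0\le\beta<1$, epoch learning rates $\eta_t$ (inner step sizes $\eta_i^{(t)}=\eta_t/n$) and the randomized reshuffling strategy. Assume that for some $\alpha>0$ we have $\eta_t\le\alpha\eta_{t-1}$ for $2\le t\le T$, and that $0<\eta_t\le\frac{1}{2L\sqrt K}$ for $1\le t\le T$, where $K=1+\alpha\beta(1+\mu\max_t\eta_t)$. Then $$\mathbb{E}\left[\|\tilde w_T-w_*\|^2\right]\le\frac{\mathbb{E}\left[\|\tilde w_0-w_*\|^2\right]}{(1-\beta)\prod_{t=1}^T(1+\mu\eta_t)}+\frac{4L\sigma^2}{3n}\sum_{j=1}^T\eta_j^3\,\frac{K-\beta}{\prod_{t=j}^T(1+\mu\eta_t)}.$$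
   Context: $[n]:=\{1,\dots,n\}$. $L$-smooth means $\|\nabla f(w;i)-\nabla f(w';i)\|\le L\|w-w'\|$ for all $w,w'\in\mathbb{R}^d$ and all $i\in[n]$. $F$ is $\mu$-strongly convex if $F(w)\ge F(\hat w)+\langle\nabla F(\hat w),w-\hat w\rangle+\frac\mu2\|w-\hat w\|^2$ for all $w,\hat w\in\mathbb{R}^d$. SMG (Shuffling Momentum Gradient) algorithm: choose $\tilde w_0\in\mathbb{R}^d$ and set $\tilde m_0:=\mathbf 0$. For $t=1,\dots,T$: set $w_0^{(t)}:=\tilde w_{t-1}$, $m_0^{(t)}:=\tilde m_{t-1}$, $v_0^{(t)}:=\mathbf 0$; generate a permutation $\pi^{(t)}$ of $[n]$; for $i=0,\dots,n-1$ set $g_i^{(t)}:=\nabla f(w_i^{(t)};\pi^{(t)}(i+1))$, $m_{i+1}^{(t)}:=\beta m_0^{(t)}+(1-\beta)g_i^{(t)}$, $v_{i+1}^{(t)}:=v_i^{(t)}+\frac1n g_i^{(t)}$, $w_{i+1}^{(t)}:=w_i^{(t)}-\frac{\eta_t}{n}m_{i+1}^{(t)}$; then set $\tilde w_t:=w_n^{(t)}$, $\tilde m_t:=v_n^{(t)}$. Randomized reshuffling: at each epoch $t$, $\pi^{(t)}$ is drawn uniformly at random from all permutations of $[n]$, independently of the previous epochs. The learning rates $\eta_t$ are deterministic; $\mathbb{E}$ is the total expectation. *)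

theory Defs
  imports "HOL-Probability.Probability"
begin

text \<open>
  The gradient is the unique vector (if there is one) that satisfies \<^const>\<open>gderiv\<close>;
  it is meaningful only at points of differentiability, which is why \<open>L_smooth\<close> asks for
  differentiability explicitly.
\<close>

definition grad :: "('a::real_inner \<Rightarrow> real) \<Rightarrow> 'a \<Rightarrow> 'a" where
  "grad f w = (THE D. GDERIV f w :> D)"

definition L_smooth :: "real \<Rightarrow> ('a::real_inner \<Rightarrow> real) \<Rightarrow> bool" where
  "L_smooth L f \<longleftrightarrow>
     (\<forall>w. f differentiable (at w)) \<and>
     (\<forall>w w'. norm (grad f w - grad f w') \<le> L * norm (w - w'))"

definition strongly_convex :: "real \<Rightarrow> ('a::real_inner \<Rightarrow> real) \<Rightarrow> bool" where
  "strongly_convex \<mu> F \<longleftrightarrow>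
     (\<forall>w w'. F w \<ge> F w' + inner (grad F w') (w - w') + \<mu> / 2 * (norm (w - w'))\<^sup>2)"

text \<open>
  In \<open>smg_inner f n \<beta> \<eta> p w0 m0 i\<close>, the pair after \<open>i\<close> inner steps of one epoch is
  \<open>(w\<^sub>i, v\<^sub>i)\<close>, where \<open>p\<close> is the permutation, \<open>\<eta>\<close> the learning rate and \<open>(w0, m0)\<close> the
  starting point and momentum of the epoch.  The momentum \<open>m\<^sub>i\<^sub>+\<^sub>1\<close> depends on \<open>m0\<close>
  and the current gradient only, not on \<open>m\<^sub>i\<close>.
\<close>

primrec smg_inner ::
  "(nat \<Rightarrow> 'a::real_inner \<Rightarrow> real) \<Rightarrow> nat \<Rightarrow> real \<Rightarrow> real \<Rightarrow> (nat \<Rightarrow> nat) \<Rightarrow> 'a \<Rightarrow> 'a \<Rightarrow> nat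
     \<Rightarrow> 'a \<times> 'a" where
  "smg_inner f n \<beta> \<eta> p w0 m0 0 = (w0, 0)"
| "smg_inner f n \<beta> \<eta> p w0 m0 (Suc i) =
     (let (w, v) = smg_inner f n \<beta> \<eta> p w0 m0 i;
          g = grad (f (p (i + 1))) w;
          m = \<beta> *\<^sub>R m0 + (1 - \<beta>) *\<^sub>R g
      in (w - (\<eta> / real n) *\<^sub>R m, v + (1 / real n) *\<^sub>R g))"

text \<open>
  \<open>smg f n \<beta> \<eta> \<pi> w0 t\<close> is the pair of the iterate and the momentum after \<open>t\<close> epochs.
  Epochs are numbered from 1: epoch \<open>t\<close> uses \<open>\<eta> t\<close> and \<open>\<pi> t\<close>.
\<close>

primrec smg ::
  "(nat \<Rightarrow> 'a::real_inner \<Rightarrow> real) \<Rightarrow> nat \<Rightarrow> real \<Rightarrow> (nat \<Rightarrow> real) \<Rightarrow> (nat \<Rightarrow> nat \<Rightarrow> nat) \<Rightarrow> 'a \<Rightarrow> nat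
     \<Rightarrow> 'a \<times> 'a" where
  "smg f n \<beta> \<eta> \<pi> w0 0 = (w0, 0)"
| "smg f n \<beta> \<eta> \<pi> w0 (Suc t) =
     (let (w, m) = smg f n \<beta> \<eta> \<pi> w0 t
      in smg_inner f n \<beta> (\<eta> (Suc t)) (\<pi> (Suc t)) w m n)"

text \<open>
  The initial point \<open>W0\<close> may be random.  It plays the role of index 0 in the mutually
  independent family \<open>W0, \<pi> 1, \<dots>, \<pi> T\<close>; \<open>indep_vars\<close> does not apply because the types differ.
\<close>

definition (in prob_space) randomized_reshuffling ::
  "nat \<Rightarrow> nat \<Rightarrow> (nat \<Rightarrow> 'a \<Rightarrow> nat \<Rightarrow> nat) \<Rightarrow> ('a \<Rightarrow> 'b::topological_space) \<Rightarrow> bool" where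
  "randomized_reshuffling n T \<pi> W0 \<longleftrightarrow>
     random_variable borel W0 \<and>
     (\<forall>t\<in>{1..T}. random_variable (count_space UNIV) (\<pi> t) \<and>
        distr M (count_space UNIV) (\<pi> t) =
          measure_pmf (pmf_of_set {p. p permutes {1..n}})) \<and>
     indep_sets
       (\<lambda>t. if t = 0 then sets (vimage_algebra (space M) W0 borel)
            else sets (vimage_algebra (space M) (\<pi> t) (count_space UNIV))) {0..T}"

end

theory Submission
  imports Defs
begin

text \<open>
  The proof compares consecutive epochs for each fixed choice of the permutations, and takes
  expectations only at the very end.

  Write \<open>x\<^sub>t\<close> for the distance vector from \<open>wstar\<close> to the iterate after epoch \<open>t\<close>. The epoch moves the
  iterate by \<open>- \<eta>\<^sub>t d\<close>, where \<open>d\<close> mixes the mean gradients of epochs \<open>t - 1\<close> and \<open>t\<close> with weights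
  \<open>\<beta>\<close> and \<open>1 - \<beta>\<close>, so the squared norm of \<open>x\<^sub>t\<^sub>-\<^sub>1\<close> is that of \<open>x\<^sub>t\<close> plus
  \<open>2 \<eta>\<^sub>t \<langle>d, x\<^sub>t\<rangle> + \<eta>\<^sub>t\<^sup>2 \<parallel>d\<parallel>\<^sup>2\<close>. Expanding around the \<^emph>\<open>new\<close> iterate is what produces the factors
  \<open>1 + \<mu> \<eta>\<^sub>t\<close>. For a convex smooth component, the gradient at an inner iterate still points away from
  \<open>wstar\<close> as seen from the new iterate (\<open>convex_smooth_inner_grad_ge\<close>), up to a loss \<open>A\<^sub>t\<close> (the mean
  squared distance from the inner iterates to the end of the epoch, \<open>spread\<close>) and with a gain \<open>B\<^sub>t\<close>
  (the mean squared difference between the gradients used and those at \<open>wstar\<close>,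
  \<open>gradient_deviation\<close>).

  The loss is quadratic in the step size. Splitting each gradient into its value at \<open>wstar\<close> and the
  rest gives \<open>A\<^sub>t \<le> \<eta>\<^sub>t\<^sup>2 (\<beta> B\<^sub>t\<^sub>-\<^sub>1 + 2 (1 - \<beta>) (B\<^sub>t + S\<^sub>t))\<close> (\<open>spread_smg_inner_le\<close>), where \<open>S\<^sub>t\<close>
  (\<open>shuffling_noise\<close>) is built from partial sums of the gradients at \<open>wstar\<close> in the order given by the
  permutation. The step size bound \<open>4 L\<^sup>2 \<eta>\<^sub>t\<^sup>2 K \<le> 1\<close> makes the gain absorb every \<open>B\<close> here, and only
  \<open>S\<^sub>t\<close> remains.

  The momentum makes epoch \<open>t\<close> suffer also from \<open>A\<^sub>t\<^sub>-\<^sub>1\<close>. This delay is handled by the Lyapunov function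
  \<open>\<parallel>x\<^sub>t\<parallel>\<^sup>2 + 2 (K - 1) \<eta>\<^sub>t L A\<^sub>t / (1 + \<mu> \<eta>\<^sub>t)\<close>: the value of \<open>K\<close> is exactly what lets the reserve set
  aside in epoch \<open>t - 1\<close> pay for the delayed loss, given \<open>\<eta>\<^sub>t \<le> \<alpha> \<eta>\<^sub>t\<^sub>-\<^sub>1\<close>. It contracts by
  \<open>1 + \<mu> \<eta>\<^sub>t\<close> per epoch up to the error \<open>4 L (K - \<beta>) \<eta>\<^sub>t\<^sup>3 S\<^sub>t\<close> (\<open>later_epoch\<close>). The first epoch has no
  earlier gradient behind its momentum and gains only \<open>1 + (1 - \<beta>) \<mu> \<eta>\<^sub>1\<close>, which is at least
  \<open>(1 - \<beta>) (1 + \<mu> \<eta>\<^sub>1)\<close>; hence the factor \<open>1 - \<beta>\<close> under the initial error (\<open>first_epoch\<close>).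

  Finally, the gradients at \<open>wstar\<close> sum to zero, so sampling them without replacement makes a sum of
  \<open>k\<close> of them have second moment proportional to \<open>k (n - k)\<close>; this gives a mean of \<open>S\<^sub>t\<close> of at most
  \<open>\<sigma>sq / (3 n)\<close> (\<open>mean_shuffling_noise_le\<close>).
\<close>

section \<open>Gradients of convex smooth functions\<close>

text \<open>
  In a Euclidean space every linear functional is an inner product with a fixed vector, so a
  derivative always yields a gradient, and \<^const>\<open>grad\<close> picks the only one.
\<close>

lemma GDERIV_grad:
  fixes f :: "'a::euclidean_space \<Rightarrow> real"
  assumes "f differentiable (at w)"
  shows "GDERIV f w :> grad f w"
proof -
  obtain f' where f': "(f has_derivative f') (at w)"
    using assms by (auto simp: differentiable_def)
  have lin: "linear f'"
    using f' has_derivative_linear by blast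
  define D where "D = (\<Sum>b\<in>Basis. f' b *\<^sub>R b)"
  have "f' h = inner h D" for h
  proof -
    have "f' h = f' (\<Sum>b\<in>Basis. inner h b *\<^sub>R b)"
      by (simp add: euclidean_representation)
    also have "\<dots> = (\<Sum>b\<in>Basis. inner h b * f' b)"
      by (simp add: linear_sum[OF lin] linear_scale[OF lin])
    also have "\<dots> = inner h D"
      unfolding D_def by (simp add: inner_sum_right mult.commute)
    finally show ?thesis .
  qed
  then have D: "GDERIV f w :> D"
    using f' unfolding gderiv_def by (metis (no_types, lifting) ext)
  moreover have "D' = D" if "GDERIV f w :> D'" for D'
  proof -
    have "(\<lambda>h. inner h D') = (\<lambda>h. inner h D)"
      using that D unfolding gderiv_def by (rule has_derivative_unique)
    then show ?thesis
      by (metis vector_eq_ldot)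
  qed
  ultimately show ?thesis
    unfolding grad_def by (rule theI)
qed

lemma has_real_derivative_along_line:
  assumes "GDERIV f (x + t *\<^sub>R v) :> D"
  shows "((\<lambda>t. f (x + t *\<^sub>R v)) has_real_derivative inner D v) (at t)"
proof -
  have "((\<lambda>t. x + t *\<^sub>R v) has_derivative (\<lambda>h. h *\<^sub>R v)) (at t)"
    by (auto intro!: derivative_eq_intros)
  from has_derivative_compose[OF this assms[unfolded gderiv_def]]
  show ?thesis
    by (simp add: has_field_derivative_def inner_commute mult.commute[of _ "inner D v"])
qed

text \<open>
  This reduces to one real variable: along the line through \<open>x\<close> and \<open>y\<close> the function is convex and its
  slope at \<open>x\<close> is \<open>inner D (y - x)\<close>.
\<close>

lemma convex_ge_tangent:
  fixes f :: "'a::real_inner \<Rightarrow> real"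
  assumes convex: "convex_on UNIV f" and "GDERIV f x :> D"
  shows "f y \<ge> f x + inner D (y - x)"
proof -
  let ?\<phi> = "\<lambda>t::real. f (x + t *\<^sub>R (y - x))"
  have "convex_on UNIV ?\<phi>"
  proof (rule convex_onI)
    fix t a b :: real
    assume t: "0 < t" "t < 1"
    have "x + ((1 - t) *\<^sub>R a + t *\<^sub>R b) *\<^sub>R (y - x)
        = (1 - t) *\<^sub>R (x + a *\<^sub>R (y - x)) + t *\<^sub>R (x + b *\<^sub>R (y - x))"
      by (simp add: algebra_simps)
    then show "?\<phi> ((1 - t) *\<^sub>R a + t *\<^sub>R b) \<le> (1 - t) * ?\<phi> a + t * ?\<phi> b"
      using convex_onD[OF convex, of t "x + a *\<^sub>R (y - x)" "x + b *\<^sub>R (y - x)"] t by simp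
  qed auto
  moreover have "(?\<phi> has_real_derivative inner D (y - x)) (at 0)"
    by (rule has_real_derivative_along_line) (use assms in simp)
  ultimately have "inner D (y - x) * (1 - 0) \<le> ?\<phi> 1 - ?\<phi> 0"
    by (intro convex_on_imp_above_tangent[where A = UNIV]) auto
  then show ?thesis by simp
qed

text \<open>
  Along the segment from \<open>x\<close> to \<open>y\<close>, the gap between the function and the quadratic has nonpositive
  derivative because the gradient changes at most at rate \<open>L\<close>.
\<close>

lemma L_smooth_le_quadratic:
  fixes f :: "'a::euclidean_space \<Rightarrow> real"
  assumes smooth: "L_smooth L f"
  shows "f y \<le> f x + inner (grad f x) (y - x) + L / 2 * (norm (y - x))\<^sup>2"
proof -
  define v where "v = y - x"
  define h where "h t = f (x + t *\<^sub>R v) - t * inner (grad f x) v - L / 2 * t\<^sup>2 * (norm v)\<^sup>2" for t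
  have "h 1 \<le> h 0"
  proof (rule DERIV_nonpos_imp_nonincreasing[where f = h])
    fix t :: real assume t: "0 \<le> t" "t \<le> 1"
    let ?g = "grad f (x + t *\<^sub>R v)"
    have "((\<lambda>t. f (x + t *\<^sub>R v)) has_real_derivative inner ?g v) (at t)"
      using smooth by (intro has_real_derivative_along_line GDERIV_grad) (simp add: L_smooth_def)
    then have "(h has_real_derivative
        inner ?g v - inner (grad f x) v - L * t * (norm v)\<^sup>2) (at t)"
      unfolding h_def by (auto intro!: derivative_eq_intros)
    moreover have "inner (?g - grad f x) v \<le> L * t * (norm v)\<^sup>2"
    proof -
      have "inner (?g - grad f x) v \<le> norm (?g - grad f x) * norm v"
        by (rule norm_cauchy_schwarz)
      also have "\<dots> \<le> (L * norm (t *\<^sub>R v)) * norm v"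
      proof (rule mult_right_mono)
        show "norm (?g - grad f x) \<le> L * norm (t *\<^sub>R v)"
          using smooth unfolding L_smooth_def by (metis add_diff_cancel_left')
      qed simp
      finally show ?thesis
        using t by (simp add: power2_eq_square mult.assoc)
    qed
    ultimately show "\<exists>y. (h has_real_derivative y) (at t) \<and> y \<le> 0"
      by (auto simp: inner_diff_left)
  qed simp
  then show ?thesis
    by (simp add: h_def v_def)
qed

text \<open>
  Subtracting the tangent at \<open>x\<close> turns \<open>x\<close> into a global minimizer. A gradient step of length \<open>1 / L\<close>
  from \<open>y\<close> lowers the modified function by the last term, and it cannot go below the minimum.
\<close>

lemma convex_smooth_ge_tangent:
  fixes f :: "'a::euclidean_space \<Rightarrow> real"
  assumes convex: "convex_on UNIV f" and smooth: "L_smooth L f" and "L > 0"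
  shows "f y \<ge> f x + inner (grad f x) (y - x) + (norm (grad f x - grad f y))\<^sup>2 / (2 * L)"
proof -
  define d where "d = grad f y - grad f x"
  define z where "z = y - (1 / L) *\<^sub>R d"
  have "f x + inner (grad f x) (z - x) \<le> f z"
    using smooth by (intro convex_ge_tangent convex GDERIV_grad) (simp add: L_smooth_def)
  also have "f z \<le> f y + inner (grad f y) (z - y) + L / 2 * (norm (z - y))\<^sup>2"
    by (rule L_smooth_le_quadratic[OF smooth])
  also have "L / 2 * (norm (z - y))\<^sup>2 = (norm d)\<^sup>2 / (2 * L)"
    using \<open>L > 0\<close> by (simp add: z_def power_mult_distrib power_divide power2_eq_square field_simps)
  also have "inner (grad f y) (z - y) = inner (grad f x) (z - y) + inner d (z - y)"
    by (simp add: d_def inner_diff_left)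
  also have "inner d (z - y) = - (norm d)\<^sup>2 / L"
    by (simp add: z_def power2_norm_eq_inner)
  finally have "f x + inner (grad f x) (y - x) + ((norm d)\<^sup>2 / L - (norm d)\<^sup>2 / (2 * L)) \<le> f y"
    by (simp add: inner_diff_right algebra_simps)
  moreover have "(norm d)\<^sup>2 / L - (norm d)\<^sup>2 / (2 * L) = (norm (grad f x - grad f y))\<^sup>2 / (2 * L)"
    using \<open>L > 0\<close> by (simp add: d_def norm_minus_commute field_simps)
  ultimately show ?thesis by simp
qed

text \<open>
  The gradient used at an inner iterate \<open>u\<close>, tested against the vector from \<open>z\<close> (the optimum) to \<open>y\<close>
  (the end of an epoch): smoothness carries the value from \<open>u\<close> to \<open>y\<close>, convexity from \<open>u\<close> to \<open>z\<close>. The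
  last term is the gain that later pays for the spread of the inner iterates.
\<close>

lemma convex_smooth_inner_grad_ge:
  fixes f :: "'a::euclidean_space \<Rightarrow> real"
  assumes "convex_on UNIV f" and "L_smooth L f" and "L > 0"
  shows "inner (grad f u) (y - z)
    \<ge> f y - f z - L / 2 * (norm (y - u))\<^sup>2 + (norm (grad f u - grad f z))\<^sup>2 / (2 * L)"
proof -
  have "inner (grad f u) (y - z) = inner (grad f u) (y - u) - inner (grad f u) (z - u)"
    by (simp add: inner_diff_right)
  then show ?thesis
    using L_smooth_le_quadratic[OF assms(2), of y u] convex_smooth_ge_tangent[OF assms, of u z]
    by linarith
qed

lemma GDERIV_scaled_sum:
  assumes "\<And>i. i \<in> I \<Longrightarrow> GDERIV (f i) w :> D i"
  shows "GDERIV (\<lambda>w. c * (\<Sum>i\<in>I. f i w)) w :> c *\<^sub>R (\<Sum>i\<in>I. D i)"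
proof -
  have "((\<lambda>w. c * (\<Sum>i\<in>I. f i w)) has_derivative (\<lambda>h. c * (\<Sum>i\<in>I. inner h (D i)))) (at w)"
    using assms unfolding gderiv_def by (intro has_derivative_mult_right has_derivative_sum)
  then show ?thesis
    by (simp add: gderiv_def inner_sum_right)
qed

lemma gradient_at_minimizer_eq_0:
  assumes "is_arg_min F (\<lambda>_. True) w" and "GDERIV F w :> D"
  shows "D = 0"
proof -
  have "(\<lambda>h. inner h D) = (\<lambda>h. 0)"
    using assms
    by (intro differential_zero_maxmin[of w UNIV F]) (auto simp: gderiv_def is_arg_min_linorder)
  then have "inner D D = 0" by metis
  then show ?thesis by simp
qed

section \<open>Partial sums along a uniformly random permutation\<close>

text \<open>
  The variance formula for sampling without replacement from a population with mean zero. By symmetry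
  the correlation of two positions depends only on whether they coincide, and since the whole
  population sums to zero, \<open>N - 1\<close> equal off-diagonal correlations cancel one diagonal term, where \<open>N\<close>
  is the size of the population. The factor \<open>N (N - 1)\<close> stands on the left to avoid dividing by zero.
\<close>

lemma sum_permutations_norm_partial_sum:
  fixes G :: "'b \<Rightarrow> 'a::real_inner"
  assumes S: "finite S" and "I \<subseteq> S" and centered: "(\<Sum>s\<in>S. G s) = 0"
  shows "real (card S) * (real (card S) - 1) *
           (\<Sum>p | p permutes S. (norm (\<Sum>a\<in>I. G (p a)))\<^sup>2)
       = real (card I) * (real (card S) - real (card I)) * fact (card S) * (\<Sum>s\<in>S. (norm (G s))\<^sup>2)"
proof -
  define q where "q a b = (\<Sum>p | p permutes S. inner (G (p a)) (G (p b)))" for a b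
  let ?N = "real (card S)" and ?k = "real (card I)"
  have I: "finite I"
    using S \<open>I \<subseteq> S\<close> by (rule rev_finite_subset)
  have q_transpose: "q a b = q (Transposition.transpose c d a) (Transposition.transpose c d b)" if "c \<in> S" "d \<in> S" for a b c d
    unfolding q_def
    by (subst sum_permutations_compose_right[OF permutes_swap_id[OF that]]) simp
  have sum_perm: "(\<Sum>a\<in>S. h (p a)) = (\<Sum>a\<in>S. h a)" if "p permutes S" for p and h :: "'b \<Rightarrow> 'c::comm_monoid_add"
    using sum.permute[OF that, of h] by (simp add: o_def)
  have diag: "?N * q a a = fact (card S) * (\<Sum>s\<in>S. (norm (G s))\<^sup>2)" if a: "a \<in> S" for a
  proof -
    have "?N * q a a = (\<Sum>b\<in>S. q a a)" by simp
    also have "\<dots> = (\<Sum>b\<in>S. q b b)"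
      using q_transpose[OF a] by (intro sum.cong refl) (metis transpose_apply_first)
    also have "\<dots> = (\<Sum>p | p permutes S. \<Sum>b\<in>S. (norm (G (p b)))\<^sup>2)"
      unfolding q_def by (subst sum.swap) (simp add: power2_norm_eq_inner)
    also have "\<dots> = fact (card S) * (\<Sum>s\<in>S. (norm (G s))\<^sup>2)"
      using sum_perm[of _ "\<lambda>s. (norm (G s))\<^sup>2"] S by (simp add: card_permutations)
    finally show ?thesis .
  qed
  have row: "(\<Sum>b\<in>S. q a b) = 0" for a
    unfolding q_def by (subst sum.swap) (simp add: sum_perm centered flip: inner_sum_right)
  have offdiag: "(?N - 1) * q a b = - q a a" if "a \<in> S" "b \<in> S" "a \<noteq> b" for a b
  proof -
    have "q a c = q a b" if "c \<in> S - {a}" for c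
      using q_transpose[of b c a b] that \<open>b \<in> S\<close> \<open>a \<noteq> b\<close> by (auto simp: transpose_def split: if_splits)
    then have "(\<Sum>c\<in>S - {a}. q a c) = (\<Sum>c\<in>S - {a}. q a b)"
      by (intro sum.cong) auto
    then show ?thesis
      using row[of a] S that sum.remove[of S a "q a"] card_gt_0_iff[of S]
      by (auto simp: of_nat_diff Suc_leI)
  qed
  have col: "(?N - 1) * (\<Sum>b\<in>I. q a b) = (?N - ?k) * q a a" if a: "a \<in> I" for a
  proof -
    have "a \<in> S" using a \<open>I \<subseteq> S\<close> by auto
    have "1 \<le> card I" using a I by (metis One_nat_def Suc_leI card_gt_0_iff empty_iff)
    have "(?N - 1) * (\<Sum>b\<in>I. q a b) = (?N - 1) * q a a + (\<Sum>b\<in>I - {a}. (?N - 1) * q a b)"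
      using I a by (simp add: sum.remove[of I a] sum_distrib_left distrib_left)
    also have "(\<Sum>b\<in>I - {a}. (?N - 1) * q a b) = (\<Sum>b\<in>I - {a}. - q a a)"
      using \<open>I \<subseteq> S\<close> \<open>a \<in> S\<close> by (intro sum.cong offdiag) auto
    finally show ?thesis
      using I a \<open>1 \<le> card I\<close> by (simp add: of_nat_diff algebra_simps)
  qed
  have "(norm (\<Sum>a\<in>I. G (p a)))\<^sup>2 = (\<Sum>a\<in>I. \<Sum>b\<in>I. inner (G (p a)) (G (p b)))" for p
    by (simp add: power2_norm_eq_inner inner_sum_left) (simp add: inner_sum_right)
  then have "(\<Sum>p | p permutes S. (norm (\<Sum>a\<in>I. G (p a)))\<^sup>2)
      = (\<Sum>p | p permutes S. \<Sum>a\<in>I. \<Sum>b\<in>I. inner (G (p a)) (G (p b)))"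
    by simp
  also have "\<dots> = (\<Sum>a\<in>I. \<Sum>b\<in>I. q a b)"
    unfolding q_def by (subst sum.swap, rule sum.cong[OF refl], rule sum.swap)
  finally have "?N * (?N - 1) * (\<Sum>p | p permutes S. (norm (\<Sum>a\<in>I. G (p a)))\<^sup>2)
      = (\<Sum>a\<in>I. ?N * ((?N - 1) * (\<Sum>b\<in>I. q a b)))"
    by (simp add: sum_distrib_left mult.assoc)
  also have "\<dots> = (\<Sum>a\<in>I. (?N - ?k) * (?N * q a a))"
    by (intro sum.cong refl) (simp add: col)
  also have "\<dots> = (\<Sum>a\<in>I. (?N - ?k) * (fact (card S) * (\<Sum>s\<in>S. (norm (G s))\<^sup>2)))"
    using \<open>I \<subseteq> S\<close> by (intro sum.cong refl) (auto simp: diag)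
  finally show ?thesis by simp
qed

text \<open>
  The total of the variances \<open>k (n - k)\<close> over all partial sums along a permutation.
\<close>

lemma sum_diff_mult_index: "(\<Sum>i<n. (real n - real i) * real i) = real n * ((real n)\<^sup>2 - 1) / 6"
proof -
  \<comment> \<open>The induction needs the bound of the sum separated from the other occurrence of \<open>n\<close>.\<close>
  have "6 * (\<Sum>i<m. (x - real i) * real i) = real m * (real m - 1) * (3 * x - 2 * real m + 1)"
    for m :: nat and x :: real
    by (induction m) (simp_all add: algebra_simps)
  from this[of "real n" n] show ?thesis
    by (simp add: power2_eq_square algebra_simps)
qed
section \<open>Norm inequalities and sums over one epoch\<close>

lemma norm_sum_squared_le:
  fixes x :: "'b \<Rightarrow> 'a::real_normed_vector"
  shows "(norm (\<Sum>j\<in>J. x j))\<^sup>2 \<le> real (card J) * (\<Sum>j\<in>J. (norm (x j))\<^sup>2)"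
proof -
  have "(norm (\<Sum>j\<in>J. x j))\<^sup>2 \<le> (\<Sum>j\<in>J. norm (x j))\<^sup>2"
    by (intro power_mono norm_sum) simp
  also have "\<dots> \<le> real (card J) * (\<Sum>j\<in>J. (norm (x j))\<^sup>2)"
    using sum_squared_le_sum_of_squares[of "\<lambda>j. norm (x j)" J] by (simp add: mult.commute)
  finally show ?thesis .
qed

lemma norm_add_squared_le:
  fixes x y :: "'a::real_inner"
  shows "(norm (x + y))\<^sup>2 \<le> 2 * (norm x)\<^sup>2 + 2 * (norm y)\<^sup>2"
  using zero_le_power2[of "norm (x - y)"]
  by (simp add: power2_norm_eq_inner inner_add inner_diff inner_commute)

lemma norm_convex_combination_squared_le:
  fixes x y :: "'a::real_inner"
  assumes "0 \<le> \<beta>" "\<beta> \<le> 1"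
  shows "(norm (\<beta> *\<^sub>R x + (1 - \<beta>) *\<^sub>R y))\<^sup>2 \<le> \<beta> * (norm x)\<^sup>2 + (1 - \<beta>) * (norm y)\<^sup>2"
proof -
  have "\<beta> * (norm x)\<^sup>2 + (1 - \<beta>) * (norm y)\<^sup>2 - (norm (\<beta> *\<^sub>R x + (1 - \<beta>) *\<^sub>R y))\<^sup>2
      = \<beta> * (1 - \<beta>) * (norm (x - y))\<^sup>2"
    by (simp add: power2_norm_eq_inner inner_add inner_diff inner_commute algebra_simps)
  moreover have "0 \<le> \<beta> * (1 - \<beta>) * (norm (x - y))\<^sup>2"
    using assms by simp
  ultimately show ?thesis by linarith
qed

text \<open>
  The expansion is around the point \<open>w1\<close> that the step reaches, not around its origin \<open>w0\<close>.
\<close>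

lemma norm_diff_step:
  fixes w0 w1 d z :: "'a::real_inner"
  assumes "w1 = w0 - \<eta> *\<^sub>R d"
  shows "(norm (w0 - z))\<^sup>2 = (norm (w1 - z))\<^sup>2 + 2 * \<eta> * inner d (w1 - z) + \<eta>\<^sup>2 * (norm d)\<^sup>2"
proof -
  have "(norm (a + \<eta> *\<^sub>R d))\<^sup>2 = (norm a)\<^sup>2 + 2 * \<eta> * inner d a + \<eta>\<^sup>2 * (norm d)\<^sup>2" for a
    unfolding power2_norm_eq_inner
    by (simp add: inner_add_left inner_add_right inner_commute[of a d] power2_eq_square algebra_simps)
  from this[of "w1 - z"] show ?thesis
    using assms by simp
qed

lemma sum_shuffled:
  fixes n :: nat
  assumes "p permutes {1..n}"
  shows "(\<Sum>i<n. h (p (i + 1))) = (\<Sum>i=1..n. h i)"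
proof -
  have "(\<Sum>i<n. h (p (i + 1))) = (\<Sum>i=1..n. h (p i))"
    by (simp add: sum.atLeast1_atMost_eq)
  also have "\<dots> = (\<Sum>i=1..n. h i)"
    using sum.permute[OF assms, of h] by (simp add: o_def)
  finally show ?thesis .
qed

section \<open>The iterates of one epoch\<close>

text \<open>
  In the following quantities \<open>u\<close> lists the inner iterates of an epoch with permutation \<open>p\<close>, from
  \<open>u 0\<close> to \<open>u n\<close>.
\<close>

definition epoch_gradient ::
  "(nat \<Rightarrow> 'a::real_inner \<Rightarrow> real) \<Rightarrow> nat \<Rightarrow> (nat \<Rightarrow> nat) \<Rightarrow> (nat \<Rightarrow> 'a) \<Rightarrow> 'a" where
  "epoch_gradient f n p u = (1 / real n) *\<^sub>R (\<Sum>i<n. grad (f (p (i + 1))) (u i))"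

definition spread :: "nat \<Rightarrow> (nat \<Rightarrow> 'a::real_normed_vector) \<Rightarrow> real" where
  "spread n u = (\<Sum>i<n. (norm (u n - u i))\<^sup>2) / real n"

definition gradient_deviation ::
  "(nat \<Rightarrow> 'a::real_inner \<Rightarrow> real) \<Rightarrow> nat \<Rightarrow> 'a \<Rightarrow> (nat \<Rightarrow> nat) \<Rightarrow> (nat \<Rightarrow> 'a) \<Rightarrow> real" where
  "gradient_deviation f n z p u =
     (\<Sum>i<n. (norm (grad (f (p (i + 1))) (u i) - grad (f (p (i + 1))) z))\<^sup>2) / real n"

text \<open>
  The squared distance from the \<open>i\<close>-th inner iterate to the end of an epoch, averaged over \<open>i\<close>, that
  would be seen with unit learning rate and no momentum if all gradients were evaluated at \<open>z\<close>.
\<close>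

definition shuffling_noise ::
  "(nat \<Rightarrow> 'a::real_inner \<Rightarrow> real) \<Rightarrow> nat \<Rightarrow> 'a \<Rightarrow> (nat \<Rightarrow> nat) \<Rightarrow> real" where
  "shuffling_noise f n z p =
     (\<Sum>i<n. (norm (\<Sum>j=i..<n. grad (f (p (j + 1))) z))\<^sup>2) / real n ^ 3"

lemma spread_nonneg: "0 \<le> spread n u"
  by (simp add: spread_def sum_nonneg)

lemma gradient_deviation_nonneg: "0 \<le> gradient_deviation f n z p u"
  by (simp add: gradient_deviation_def sum_nonneg)

lemma shuffling_noise_nonneg: "0 \<le> shuffling_noise f n z p"
  by (simp add: shuffling_noise_def sum_nonneg)

lemma smg_inner_closed_form:
  fixes f n \<beta> \<eta> w0 m0 p
  defines "u \<equiv> \<lambda>i. fst (smg_inner f n \<beta> \<eta> p w0 m0 i)"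
  shows "fst (smg_inner f n \<beta> \<eta> p w0 m0 i) = w0 - (\<eta> / real n) *\<^sub>R
           ((real i * \<beta>) *\<^sub>R m0 + (1 - \<beta>) *\<^sub>R (\<Sum>j<i. grad (f (p (j + 1))) (u j)))"
    and "snd (smg_inner f n \<beta> \<eta> p w0 m0 i) = (1 / real n) *\<^sub>R (\<Sum>j<i. grad (f (p (j + 1))) (u j))"
proof (induction i)
  case (Suc i)
  {
    case 1
    then show ?case
      using Suc unfolding u_def
      by (simp add: Let_def split_beta algebra_simps)
  next
    case 2
    then show ?case
      using Suc unfolding u_def by (simp add: Let_def split_beta algebra_simps)
  }
qed simp_all

lemma smg_inner_final_step:
  fixes f n \<beta> \<eta> w0 m0 p
  defines "u \<equiv> \<lambda>i. fst (smg_inner f n \<beta> \<eta> p w0 m0 i)"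
  assumes "n \<ge> 1"
  shows "snd (smg_inner f n \<beta> \<eta> p w0 m0 n) = epoch_gradient f n p u"
    and "u n = w0 - \<eta> *\<^sub>R (\<beta> *\<^sub>R m0 + (1 - \<beta>) *\<^sub>R epoch_gradient f n p u)"
  using assms(2) smg_inner_closed_form[of f n \<beta> \<eta> p w0 m0 n] unfolding u_def epoch_gradient_def
  by (simp_all add: algebra_simps diff_divide_distrib)

text \<open>
  Subtracting the gradients at a stationary point \<open>z\<close> does not change the mean over a whole epoch, so
  only the deviations contribute.
\<close>

lemma norm_epoch_gradient_squared_le:
  assumes p: "p permutes {1..n}" and centered: "(\<Sum>i=1..n. grad (f i) z) = 0"
  shows "(norm (epoch_gradient f n p u))\<^sup>2 \<le> gradient_deviation f n z p u"
proof -
  let ?d = "\<lambda>i. grad (f (p (i + 1))) (u i) - grad (f (p (i + 1))) z"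
  have "epoch_gradient f n p u = (1 / real n) *\<^sub>R (\<Sum>i<n. ?d i)"
    unfolding epoch_gradient_def
    using sum_shuffled[OF p, of "\<lambda>i. grad (f i) z"] centered by (simp add: sum_subtractf)
  then have "(norm (epoch_gradient f n p u))\<^sup>2 = (norm (\<Sum>i<n. ?d i))\<^sup>2 / (real n)\<^sup>2"
    by (simp add: power_divide)
  also have "\<dots> \<le> (real n * (\<Sum>i<n. (norm (?d i))\<^sup>2)) / (real n)\<^sup>2"
    using norm_sum_squared_le[of ?d "{..<n}"] by (intro divide_right_mono) auto
  also have "\<dots> = gradient_deviation f n z p u"
    by (simp add: gradient_deviation_def power2_eq_square)
  finally show ?thesis .
qed

text \<open>
  The remaining way from the \<open>i\<close>-th inner iterate consists of momentum and of the gradients from \<open>i\<close>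
  on. These split into their values at \<open>z\<close>, where cancellation along the permutation is kept, and the
  deviations from them, for which the Cauchy--Schwarz inequality is good enough. At \<open>m0 = 0\<close> the
  momentum term vanishes, which the first epoch relies on.
\<close>

lemma spread_smg_inner_le:
  fixes f :: "nat \<Rightarrow> 'a::real_inner \<Rightarrow> real" and n \<beta> \<eta>
  defines "u \<equiv> \<lambda>p w0 m0 i. fst (smg_inner f n \<beta> \<eta> p w0 m0 i)"
  assumes "n \<ge> 1" and \<beta>: "0 \<le> \<beta>" "\<beta> \<le> 1"
  shows "spread n (u p w0 m0) \<le> \<eta>\<^sup>2 * (\<beta> * (norm m0)\<^sup>2
    + 2 * (1 - \<beta>) * (gradient_deviation f n z p (u p w0 m0) + shuffling_noise f n z p))"
proof -
  define x where "x = u p w0 m0"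
  define c where "c = \<eta> / real n"
  define g where "g j = grad (f (p (j + 1))) (x j)" for j
  define h where "h j = grad (f (p (j + 1))) z" for j
  define B where "B = gradient_deviation f n z p x"
  have nB: "real n * B = (\<Sum>j<n. (norm (g j - h j))\<^sup>2)"
    using \<open>n \<ge> 1\<close> by (simp add: B_def gradient_deviation_def g_def h_def)
  have bound: "(norm (x n - x i))\<^sup>2 \<le> \<eta>\<^sup>2 * (\<beta> * (norm m0)\<^sup>2
      + 2 * (1 - \<beta>) * (B + (norm (\<Sum>j=i..<n. h j))\<^sup>2 / (real n)\<^sup>2))" if "i < n" for i
  proof -
    let ?k = "real n - real i"
    have split: "(\<Sum>j<n. g j) = (\<Sum>j<i. g j) + (\<Sum>j=i..<n. g j)"
      using sum.atLeastLessThan_concat[of 0 i n g] \<open>i < n\<close> by (simp add: atLeast0LessThan)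
    have x_eq: "x l = w0 - c *\<^sub>R ((real l * \<beta>) *\<^sub>R m0 + (1 - \<beta>) *\<^sub>R (\<Sum>j<l. g j))" for l
      unfolding x_def u_def g_def c_def by (rule smg_inner_closed_form(1))
    have "x n - x i = - (c *\<^sub>R (\<beta> *\<^sub>R (?k *\<^sub>R m0) + (1 - \<beta>) *\<^sub>R (\<Sum>j=i..<n. g j)))"
      unfolding x_eq split by (simp add: algebra_simps)
    then have "(norm (x n - x i))\<^sup>2
        = (\<eta> / real n)\<^sup>2 * (norm (\<beta> *\<^sub>R (?k *\<^sub>R m0) + (1 - \<beta>) *\<^sub>R (\<Sum>j=i..<n. g j)))\<^sup>2"
      by (simp add: c_def power_mult_distrib power_divide)
    also have "\<dots> \<le> (\<eta> / real n)\<^sup>2 *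
        (\<beta> * (norm (?k *\<^sub>R m0))\<^sup>2 + (1 - \<beta>) * (norm (\<Sum>j=i..<n. g j))\<^sup>2)"
      by (intro mult_left_mono norm_convex_combination_squared_le \<beta>) simp
    also have "\<dots> \<le> (\<eta> / real n)\<^sup>2 * (\<beta> * ((real n)\<^sup>2 * (norm m0)\<^sup>2)
        + (1 - \<beta>) * (2 * ((real n)\<^sup>2 * B) + 2 * (norm (\<Sum>j=i..<n. h j))\<^sup>2))"
    proof (intro mult_left_mono add_mono)
      have "?k\<^sup>2 \<le> (real n)\<^sup>2"
        using \<open>i < n\<close> by (intro power_mono) auto
      then show "(norm (?k *\<^sub>R m0))\<^sup>2 \<le> (real n)\<^sup>2 * (norm m0)\<^sup>2"
        by (simp add: power_mult_distrib mult_right_mono)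
      have "(norm (\<Sum>j=i..<n. g j - h j))\<^sup>2 \<le> real (n - i) * (\<Sum>j=i..<n. (norm (g j - h j))\<^sup>2)"
        using norm_sum_squared_le[of "\<lambda>j. g j - h j" "{i..<n}"] by simp
      also have "\<dots> \<le> real n * (\<Sum>j<n. (norm (g j - h j))\<^sup>2)"
        by (intro mult_mono sum_mono2 sum_nonneg) auto
      also have "\<dots> = (real n)\<^sup>2 * B"
        by (simp add: power2_eq_square nB mult.assoc)
      finally have "(norm (\<Sum>j=i..<n. g j - h j))\<^sup>2 \<le> (real n)\<^sup>2 * B" .
      moreover have "(\<Sum>j=i..<n. g j) = (\<Sum>j=i..<n. g j - h j) + (\<Sum>j=i..<n. h j)"
        by (simp add: sum_subtractf)
      ultimately show "(norm (\<Sum>j=i..<n. g j))\<^sup>2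
          \<le> 2 * ((real n)\<^sup>2 * B) + 2 * (norm (\<Sum>j=i..<n. h j))\<^sup>2"
        using norm_add_squared_le[of "\<Sum>j=i..<n. g j - h j" "\<Sum>j=i..<n. h j"] by simp
    qed (use \<beta> in auto)
    also have "\<dots> = \<eta>\<^sup>2 * (\<beta> * (norm m0)\<^sup>2
        + 2 * (1 - \<beta>) * (B + (norm (\<Sum>j=i..<n. h j))\<^sup>2 / (real n)\<^sup>2))"
      using \<open>n \<ge> 1\<close> by (simp add: power_divide field_simps)
    finally show ?thesis .
  qed
  have "(\<Sum>i<n. (norm (x n - x i))\<^sup>2) \<le> (\<Sum>i<n. \<eta>\<^sup>2 * (\<beta> * (norm m0)\<^sup>2
      + 2 * (1 - \<beta>) * (B + (norm (\<Sum>j=i..<n. h j))\<^sup>2 / (real n)\<^sup>2)))"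
    by (intro sum_mono bound) simp
  also have "\<dots> = \<eta>\<^sup>2 * (real n * (\<beta> * (norm m0)\<^sup>2)
      + 2 * (1 - \<beta>) * (real n * B + (\<Sum>i<n. (norm (\<Sum>j=i..<n. h j))\<^sup>2) / (real n)\<^sup>2))"
    by (simp add: sum.distrib flip: sum_distrib_left sum_divide_distrib)
  also have "(\<Sum>i<n. (norm (\<Sum>j=i..<n. h j))\<^sup>2) / (real n)\<^sup>2 = real n * shuffling_noise f n z p"
    using \<open>n \<ge> 1\<close>
    by (simp add: shuffling_noise_def h_def power2_eq_square power3_eq_cube)
  finally have "spread n x \<le> \<eta>\<^sup>2 * (real n * (\<beta> * (norm m0)\<^sup>2)
      + 2 * (1 - \<beta>) * (real n * B + real n * shuffling_noise f n z p)) / real n"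
    unfolding spread_def by (intro divide_right_mono) auto
  also have "\<dots> = \<eta>\<^sup>2 * (\<beta> * (norm m0)\<^sup>2 + 2 * (1 - \<beta>) * (B + shuffling_noise f n z p))"
    using \<open>n \<ge> 1\<close> by (simp add: field_simps)
  finally show ?thesis
    by (simp add: x_def B_def)
qed

section \<open>Progress in one epoch\<close>

text \<open>
  Strong convexity enters only through the quadratic growth of the objective around its minimizer.
  Both this and stationarity are stated for sums over the components, which is how the epochs use them.
\<close>

locale strongly_convex_finite_sum =
  fixes f :: "nat \<Rightarrow> 'a::euclidean_space \<Rightarrow> real" and n :: nat and L \<mu> :: real and wstar :: 'a
  assumes n_pos: "n \<ge> 1" and L_pos: "L > 0" and \<mu>_pos: "\<mu> > 0"
    and convex: "\<And>i. i \<in> {1..n} \<Longrightarrow> convex_on UNIV (f i)"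
    and smooth: "\<And>i. i \<in> {1..n} \<Longrightarrow> L_smooth L (f i)"
    and stationary: "(\<Sum>i=1..n. grad (f i) wstar) = 0"
    and growth: "real n * (\<mu> / 2 * (norm (y - wstar))\<^sup>2) \<le> (\<Sum>i=1..n. f i y - f i wstar)"
begin

abbreviation deviation where "deviation \<equiv> gradient_deviation f n wstar"
abbreviation noise where "noise \<equiv> shuffling_noise f n wstar"

text \<open>
  The average of \<open>convex_smooth_inner_grad_ge\<close> over an epoch. The point \<open>y\<close> need not belong to that
  epoch: momentum reuses the gradients of one epoch at the end of the next.
\<close>

lemma inner_epoch_gradient_ge:
  assumes p: "p permutes {1..n}"
  shows "inner (epoch_gradient f n p u) (y - wstar) \<ge> \<mu> / 2 * (norm (y - wstar))\<^sup>2
     - L / 2 * ((\<Sum>i<n. (norm (y - u i))\<^sup>2) / real n) + deviation p u / (2 * L)"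
proof -
  define D where "D i = (norm (grad (f (p (i + 1))) (u i) - grad (f (p (i + 1))) wstar))\<^sup>2" for i
  have "real n * (\<mu> / 2 * (norm (y - wstar))\<^sup>2) \<le> (\<Sum>i<n. f (p (i + 1)) y - f (p (i + 1)) wstar)"
    using growth sum_shuffled[OF p, of "\<lambda>i. f i y - f i wstar"] by simp
  then have "real n * (\<mu> / 2 * (norm (y - wstar))\<^sup>2)
        - L / 2 * (\<Sum>i<n. (norm (y - u i))\<^sup>2) + (\<Sum>i<n. D i) / (2 * L)
      \<le> (\<Sum>i<n. f (p (i + 1)) y - f (p (i + 1)) wstar - L / 2 * (norm (y - u i))\<^sup>2 + D i / (2 * L))"
    by (simp add: sum.distrib sum_subtractf sum_distrib_left sum_divide_distrib)
  also have "\<dots> \<le> (\<Sum>i<n. inner (grad (f (p (i + 1))) (u i)) (y - wstar))"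
  proof (rule sum_mono)
    fix i assume "i \<in> {..<n}"
    then have "p (i + 1) \<in> {1..n}"
      using permutes_in_image[OF p, of "i + 1"] by simp
    then show "f (p (i + 1)) y - f (p (i + 1)) wstar - L / 2 * (norm (y - u i))\<^sup>2 + D i / (2 * L)
        \<le> inner (grad (f (p (i + 1))) (u i)) (y - wstar)"
      unfolding D_def using convex_smooth_inner_grad_ge convex smooth L_pos by blast
  qed
  also have "\<dots> = real n * inner (epoch_gradient f n p u) (y - wstar)"
    using n_pos by (simp add: epoch_gradient_def inner_sum_left)
  finally have "(real n * (\<mu> / 2 * (norm (y - wstar))\<^sup>2)
        - L / 2 * (\<Sum>i<n. (norm (y - u i))\<^sup>2) + (\<Sum>i<n. D i) / (2 * L)) / real n
      \<le> inner (epoch_gradient f n p u) (y - wstar)"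
    using n_pos by (simp add: pos_divide_le_eq mult.commute)
  then show ?thesis
    using n_pos
    by (simp add: gradient_deviation_def D_def add_divide_distrib diff_divide_distrib mult.commute)
qed

lemma inner_own_epoch_gradient_ge:
  assumes "p permutes {1..n}"
  shows "inner (epoch_gradient f n p u) (u n - wstar)
    \<ge> \<mu> / 2 * (norm (u n - wstar))\<^sup>2 - L / 2 * spread n u + deviation p u / (2 * L)"
  using inner_epoch_gradient_ge[OF assms, of "u n" u] by (simp add: spread_def)

text \<open>
  For a stale epoch gradient, the distance to its inner iterates is split at the end \<open>u n\<close> of its own
  epoch. The first part is the length of the step made since then.
\<close>

lemma inner_previous_epoch_gradient_ge:
  assumes "p permutes {1..n}"
  shows "inner (epoch_gradient f n p u) (y - wstar)
    \<ge> \<mu> / 2 * (norm (y - wstar))\<^sup>2 - L * ((norm (y - u n))\<^sup>2 + spread n u) + deviation p u / (2 * L)"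
proof -
  have "(norm (y - u i))\<^sup>2 \<le> 2 * (norm (y - u n))\<^sup>2 + 2 * (norm (u n - u i))\<^sup>2" for i
    using norm_add_squared_le[of "y - u n" "u n - u i"] by simp
  then have "(\<Sum>i<n. (norm (y - u i))\<^sup>2) \<le> (\<Sum>i<n. 2 * (norm (y - u n))\<^sup>2 + 2 * (norm (u n - u i))\<^sup>2)"
    by (intro sum_mono) simp
  also have "\<dots> = 2 * real n * ((norm (y - u n))\<^sup>2 + spread n u)"
    using n_pos by (simp add: sum.distrib spread_def distrib_left flip: sum_distrib_left)
  finally have "(\<Sum>i<n. (norm (y - u i))\<^sup>2) / real n \<le> 2 * ((norm (y - u n))\<^sup>2 + spread n u)"
    using n_pos by (simp add: pos_divide_le_eq algebra_simps)
  then have "L / 2 * ((\<Sum>i<n. (norm (y - u i))\<^sup>2) / real n)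
      \<le> L / 2 * (2 * ((norm (y - u n))\<^sup>2 + spread n u))"
    using L_pos by (intro mult_left_mono) auto
  also have "\<dots> = L * ((norm (y - u n))\<^sup>2 + spread n u)"
    by simp
  finally show ?thesis
    using inner_epoch_gradient_ge[OF assms, where y = y and u = u] by linarith
qed

text \<open>
  The previous epoch enters through its inner iterates \<open>u'\<close>, its permutation \<open>p'\<close> and its spread, which
  is the delayed loss caused by momentum. The left-hand side sets aside \<open>2 * \<kappa> * \<eta> * L\<close> times the new
  spread as a reserve for the next epoch. The learning rate is small enough for two things:
  \<open>2 * \<eta> * L \<le> 1\<close> lets the term \<open>\<eta>\<^sup>2 * (norm d)\<^sup>2\<close> of \<open>norm_diff_step\<close> pay for the step length in
  \<open>inner_previous_epoch_gradient_ge\<close>, and the factor \<open>1 + \<kappa>\<close> lets the gradient deviations pay for the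
  reserve as well.
\<close>

lemma later_epoch:
  fixes \<beta> \<eta> w0 m0 p
  defines "u \<equiv> \<lambda>i. fst (smg_inner f n \<beta> \<eta> p w0 m0 i)"
  assumes p: "p permutes {1..n}" and p': "p' permutes {1..n}"
    and w0: "w0 = u' n" and m0: "m0 = epoch_gradient f n p' u'"
    and \<beta>: "0 \<le> \<beta>" "\<beta> < 1" and \<kappa>: "0 \<le> \<kappa>" and \<eta>: "0 < \<eta>" "4 * L\<^sup>2 * \<eta>\<^sup>2 * (1 + \<kappa>) \<le> 1"
  shows "(1 + \<mu> * \<eta>) * (norm (u n - wstar))\<^sup>2 + 2 * \<kappa> * \<eta> * L * spread n u
    \<le> (norm (w0 - wstar))\<^sup>2 + 2 * \<beta> * \<eta> * L * spread n u'
       + 4 * L * (1 + \<kappa> - \<beta>) * \<eta> ^ 3 * noise p"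
proof -
  define m1 where "m1 = epoch_gradient f n p u"
  define d where "d = \<beta> *\<^sub>R m0 + (1 - \<beta>) *\<^sub>R m1"
  define X0 where "X0 = (norm (w0 - wstar))\<^sup>2"
  define X1 where "X1 = (norm (u n - wstar))\<^sup>2"
  define D where "D = (norm d)\<^sup>2"
  define A0 where "A0 = spread n u'"
  define A1 where "A1 = spread n u"
  define B0 where "B0 = deviation p' u'"
  define B1 where "B1 = deviation p u"
  define S where "S = noise p"
  have "u n = w0 - \<eta> *\<^sub>R d"
    using smg_inner_final_step(2)[OF n_pos] by (simp add: u_def d_def m1_def)
  then have X0: "X0 = X1 + 2 * \<eta> * inner d (u n - wstar) + \<eta>\<^sup>2 * D"
    and moved: "(norm (u n - u' n))\<^sup>2 = \<eta>\<^sup>2 * D"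
    using norm_diff_step[of "u n" w0 \<eta> d wstar] w0
    by (simp_all add: X0_def X1_def D_def power_mult_distrib)
  have nonneg: "0 \<le> B0" "0 \<le> B1" "0 \<le> S" "0 \<le> D"
    by (simp_all add: B0_def B1_def S_def D_def gradient_deviation_nonneg shuffling_noise_nonneg)
  have A1: "A1 \<le> \<eta>\<^sup>2 * (\<beta> * B0 + 2 * (1 - \<beta>) * (B1 + S))"
  proof -
    have "(norm m0)\<^sup>2 \<le> B0"
      using norm_epoch_gradient_squared_le[OF p' stationary] by (simp add: m0 B0_def)
    then have "\<eta>\<^sup>2 * (\<beta> * (norm m0)\<^sup>2 + 2 * (1 - \<beta>) * (B1 + S))
        \<le> \<eta>\<^sup>2 * (\<beta> * B0 + 2 * (1 - \<beta>) * (B1 + S))"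
      using \<beta> by (intro mult_left_mono add_right_mono) auto
    then show ?thesis
      using spread_smg_inner_le[OF n_pos, of \<beta> f \<eta> p w0 m0 wstar] \<beta>
      by (simp add: A1_def B1_def S_def u_def)
  qed
  have L\<eta>: "2 * (\<eta> * L) \<le> 1"
  proof -
    have "(2 * (\<eta> * L))\<^sup>2 * 1 \<le> (2 * (\<eta> * L))\<^sup>2 * (1 + \<kappa>)"
      using \<kappa> by (intro mult_left_mono) auto
    also have "\<dots> \<le> 1"
      using \<eta> by (simp add: power_mult_distrib mult.commute mult.left_commute)
    finally show ?thesis
      using power2_le_imp_le[of "2 * (\<eta> * L)" 1] by simp
  qed
  have "(1 - \<beta>) * (\<mu> / 2 * X1 - L / 2 * A1 + B1 / (2 * L)) \<le> (1 - \<beta>) * inner m1 (u n - wstar)"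
    using \<beta> inner_own_epoch_gradient_ge[OF p, of u]
    by (intro mult_left_mono) (auto simp: X1_def A1_def B1_def m1_def)
  moreover have "\<beta> * (\<mu> / 2 * X1 - L * (\<eta>\<^sup>2 * D + A0) + B0 / (2 * L)) \<le> \<beta> * inner m0 (u n - wstar)"
    using \<beta> inner_previous_epoch_gradient_ge[OF p', of "u n" u'] moved
    by (intro mult_left_mono) (auto simp: X1_def A0_def B0_def m0)
  ultimately have "\<beta> * (\<mu> / 2 * X1 - L * (\<eta>\<^sup>2 * D + A0) + B0 / (2 * L))
      + (1 - \<beta>) * (\<mu> / 2 * X1 - L / 2 * A1 + B1 / (2 * L)) \<le> inner d (u n - wstar)"
    by (simp add: d_def inner_add_left)
  then have "2 * \<eta> * (\<beta> * (\<mu> / 2 * X1 - L * (\<eta>\<^sup>2 * D + A0) + B0 / (2 * L))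
      + (1 - \<beta>) * (\<mu> / 2 * X1 - L / 2 * A1 + B1 / (2 * L))) \<le> 2 * \<eta> * inner d (u n - wstar)"
    using \<eta> by (intro mult_left_mono) auto
  also have "2 * \<eta> * (\<beta> * (\<mu> / 2 * X1 - L * (\<eta>\<^sup>2 * D + A0) + B0 / (2 * L))
      + (1 - \<beta>) * (\<mu> / 2 * X1 - L / 2 * A1 + B1 / (2 * L)))
    = \<mu> * \<eta> * X1 - (1 - \<beta>) * \<eta> * L * A1 - 2 * \<beta> * \<eta> * L * A0 - 2 * (\<eta> * L) * \<beta> * (\<eta>\<^sup>2 * D)
      + \<eta> / L * (\<beta> * B0 + (1 - \<beta>) * B1)"
    using L_pos by (simp add: field_simps)
  finally have main: "(1 + \<mu> * \<eta>) * X1 \<le> X0 + (1 - \<beta>) * \<eta> * L * A1 + 2 * \<beta> * \<eta> * L * A0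
      + (2 * (\<eta> * L) * \<beta> - 1) * (\<eta>\<^sup>2 * D) - \<eta> / L * (\<beta> * B0 + (1 - \<beta>) * B1)"
    unfolding X0 by (simp add: distrib_right left_diff_distrib)
  have "2 * (\<eta> * L) * \<beta> \<le> 1 * 1"
    using L\<eta> \<beta> \<eta> L_pos by (intro mult_mono) auto
  then have "(2 * (\<eta> * L) * \<beta> - 1) * (\<eta>\<^sup>2 * D) \<le> 0"
    using nonneg by (intro mult_nonpos_nonneg) auto
  \<comment> \<open>The current loss and the reserve are paid for by the gradient deviations of both epochs, up to the noise.\<close>
  moreover have "((1 - \<beta>) + 2 * \<kappa>) * (\<eta> * L) * A1
      \<le> \<eta> / L * (\<beta> * B0 + (1 - \<beta>) * B1) + 4 * L * (1 + \<kappa> - \<beta>) * \<eta> ^ 3 * S"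
  proof -
    let ?c = "(1 - \<beta>) + 2 * \<kappa>"
    have "?c * (\<eta> * L) * A1 \<le> ?c * (\<eta> * L) * (\<eta>\<^sup>2 * (\<beta> * B0 + 2 * (1 - \<beta>) * (B1 + S)))"
      using A1 \<beta> \<kappa> \<eta> L_pos by (intro mult_left_mono) auto
    also have "\<dots> = \<eta> / L * (?c * (L\<^sup>2 * \<eta>\<^sup>2) * (\<beta> * B0 + 2 * (1 - \<beta>) * B1))
        + 2 * L * \<eta> ^ 3 * (?c * (1 - \<beta>)) * S"
      using L_pos by (simp add: field_simps power2_eq_square power3_eq_cube)
    also have "\<dots> \<le> \<eta> / L * (\<beta> * B0 + (1 - \<beta>) * B1) + 2 * L * \<eta> ^ 3 * (2 * (1 + \<kappa> - \<beta>)) * S"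
    proof (intro add_mono mult_left_mono mult_right_mono)
      have "\<beta> * B0 + 2 * (1 - \<beta>) * B1 \<le> 2 * (\<beta> * B0 + (1 - \<beta>) * B1)"
        using mult_nonneg_nonneg[OF \<beta>(1) nonneg(1)] by (simp add: algebra_simps)
      then have "?c * (L\<^sup>2 * \<eta>\<^sup>2) * (\<beta> * B0 + 2 * (1 - \<beta>) * B1)
          \<le> (2 * (1 + \<kappa>)) * (L\<^sup>2 * \<eta>\<^sup>2) * (2 * (\<beta> * B0 + (1 - \<beta>) * B1))"
        using \<beta> \<kappa> nonneg by (intro mult_mono) auto
      also have "\<dots> = (4 * L\<^sup>2 * \<eta>\<^sup>2 * (1 + \<kappa>)) * (\<beta> * B0 + (1 - \<beta>) * B1)"
        by (simp add: algebra_simps)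
      also have "\<dots> \<le> 1 * (\<beta> * B0 + (1 - \<beta>) * B1)"
        using \<eta> \<beta> nonneg by (intro mult_right_mono) auto
      finally show "?c * (L\<^sup>2 * \<eta>\<^sup>2) * (\<beta> * B0 + 2 * (1 - \<beta>) * B1) \<le> \<beta> * B0 + (1 - \<beta>) * B1"
        by simp
      have "?c * (1 - \<beta>) \<le> ?c * 1"
        using \<beta> \<kappa> by (intro mult_left_mono) auto
      then show "?c * (1 - \<beta>) \<le> 2 * (1 + \<kappa> - \<beta>)"
        using \<beta> by simp
    qed (use \<eta> L_pos nonneg in auto)
    finally show ?thesis by (simp add: algebra_simps)
  qed
  ultimately have "(1 + \<mu> * \<eta>) * X1 + 2 * \<kappa> * \<eta> * L * A1
      \<le> X0 + 2 * \<beta> * \<eta> * L * A0 + 4 * L * (1 + \<kappa> - \<beta>) * \<eta> ^ 3 * S"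
    using main by (simp add: algebra_simps)
  then show ?thesis
    by (simp add: X0_def X1_def A0_def A1_def S_def)
qed

text \<open>
  With zero momentum only the weight \<open>1 - \<beta>\<close> of the direction gives progress, so the contraction factor
  is \<open>q = 1 + (1 - \<beta>) * \<mu> * \<eta>\<close> instead of \<open>a = 1 + \<mu> * \<eta>\<close>. Rescaling by \<open>a / q \<le> 1 / (1 - \<beta>)\<close> brings
  the estimate into the form of the later epochs. The rescaled weight \<open>\<theta>\<close> of the loss and of the gain
  lies between \<open>1 - \<beta>\<close> and \<open>1\<close>; it may come close to \<open>1\<close>, and then the factor \<open>1 - \<beta>\<close> in the
  spread of an epoch without momentum keeps the error below \<open>4 * L * (1 + \<kappa> - \<beta>) * \<eta> ^ 3 * noise p\<close>.
\<close>

lemma first_epoch: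
  fixes \<beta> \<eta> w0 p
  defines "u \<equiv> \<lambda>i. fst (smg_inner f n \<beta> \<eta> p w0 0 i)"
  assumes p: "p permutes {1..n}"
    and \<beta>: "0 \<le> \<beta>" "\<beta> < 1" and \<kappa>: "0 \<le> \<kappa>" and \<eta>: "0 < \<eta>" "4 * L\<^sup>2 * \<eta>\<^sup>2 * (1 + \<kappa>) \<le> 1"
  shows "(1 + \<mu> * \<eta>) * (norm (u n - wstar))\<^sup>2 + 2 * \<kappa> * \<eta> * L * spread n u
    \<le> (norm (w0 - wstar))\<^sup>2 / (1 - \<beta>) + 4 * L * (1 + \<kappa> - \<beta>) * \<eta> ^ 3 * noise p"
proof -
  define d where "d = (1 - \<beta>) *\<^sub>R epoch_gradient f n p u"
  define X0 where "X0 = (norm (w0 - wstar))\<^sup>2"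
  define X1 where "X1 = (norm (u n - wstar))\<^sup>2"
  define A1 where "A1 = spread n u"
  define B1 where "B1 = deviation p u"
  define S where "S = noise p"
  define a where "a = 1 + \<mu> * \<eta>"
  define q where "q = 1 + (1 - \<beta>) * (\<mu> * \<eta>)"
  define \<theta> where "\<theta> = (1 - \<beta>) * a / q"
  have nonneg: "0 \<le> X0" "0 \<le> B1" "0 \<le> S"
    by (simp_all add: X0_def B1_def S_def gradient_deviation_nonneg shuffling_noise_nonneg)
  have "0 < \<mu> * \<eta>" using \<mu>_pos \<eta> by simp
  moreover from this have "\<beta> * (\<mu> * \<eta>) \<le> \<mu> * \<eta>"
    using \<beta> by (simp add: mult_left_le_one_le)
  ultimately have "0 < a" "0 < q" "q \<le> a" "(1 - \<beta>) * a \<le> q"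
    using \<beta> by (auto simp: a_def q_def algebra_simps intro: add_pos_nonneg)
  then have \<theta>: "1 - \<beta> \<le> \<theta>" "\<theta> \<le> 1" "a / q \<le> 1 / (1 - \<beta>)"
    using \<beta> mult_left_mono[of q a "1 - \<beta>"] by (auto simp: \<theta>_def field_simps)
  have "u n = w0 - \<eta> *\<^sub>R d"
    using smg_inner_final_step(2)[OF n_pos, of f \<beta> \<eta> p w0 0] by (simp add: u_def d_def)
  then have X0: "X0 = X1 + 2 * \<eta> * inner d (u n - wstar) + \<eta>\<^sup>2 * (norm d)\<^sup>2"
    using norm_diff_step[of "u n" w0 \<eta> d wstar] by (simp add: X0_def X1_def)
  have A1: "A1 \<le> 2 * \<eta>\<^sup>2 * (1 - \<beta>) * (B1 + S)"
    using spread_smg_inner_le[OF n_pos, of \<beta> f \<eta> p w0 0 wstar] \<beta>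
    by (simp add: A1_def B1_def S_def u_def algebra_simps)
  have "(1 - \<beta>) * (\<mu> * \<eta>) * X1 - (1 - \<beta>) * (\<eta> * L * A1 - \<eta> / L * B1)
      = 2 * \<eta> * ((1 - \<beta>) * (\<mu> / 2 * X1 - L / 2 * A1 + B1 / (2 * L)))"
    using L_pos by (simp add: field_simps)
  also have "\<dots> \<le> 2 * \<eta> * ((1 - \<beta>) * inner (epoch_gradient f n p u) (u n - wstar))"
    using \<eta> \<beta> inner_own_epoch_gradient_ge[OF p, of u]
    by (intro mult_left_mono) (auto simp: X1_def A1_def B1_def)
  also have "\<dots> = 2 * \<eta> * inner d (u n - wstar)"
    by (simp add: d_def)
  finally have "q * X1 \<le> X0 - \<eta>\<^sup>2 * (norm d)\<^sup>2 + (1 - \<beta>) * (\<eta> * L * A1 - \<eta> / L * B1)"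
    unfolding X0 q_def by (simp add: distrib_right)
  moreover have "0 \<le> \<eta>\<^sup>2 * (norm d)\<^sup>2" by simp
  ultimately have "q * X1 \<le> X0 + (1 - \<beta>) * (\<eta> * L * A1 - \<eta> / L * B1)"
    by linarith
  then have "a / q * (q * X1) \<le> a / q * (X0 + (1 - \<beta>) * (\<eta> * L * A1 - \<eta> / L * B1))"
    using \<open>0 < a\<close> \<open>0 < q\<close> by (intro mult_left_mono) auto
  then have "a * X1 \<le> a / q * X0 + \<theta> * (\<eta> * L * A1 - \<eta> / L * B1)"
    using \<open>0 < q\<close> by (simp add: \<theta>_def distrib_left mult_ac)
  also have "a / q * X0 \<le> 1 / (1 - \<beta>) * X0"
    using \<theta> nonneg by (intro mult_right_mono) auto
  finally have main: "a * X1 \<le> X0 / (1 - \<beta>) + \<theta> * (\<eta> * L * A1 - \<eta> / L * B1)"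
    by simp
  \<comment> \<open>Both the loss and the reserve for the second epoch are paid for by the gradient deviation, up to the noise.\<close>
  have "(\<theta> + 2 * \<kappa>) * (\<eta> * L) * A1 \<le> \<theta> * (\<eta> / L) * B1 + 4 * L * (1 + \<kappa> - \<beta>) * \<eta> ^ 3 * S"
  proof -
    let ?c = "\<theta> + 2 * \<kappa>"
    have "?c * (\<eta> * L) * A1 \<le> ?c * (\<eta> * L) * (2 * \<eta>\<^sup>2 * (1 - \<beta>) * (B1 + S))"
      using A1 \<beta> \<kappa> \<eta> \<theta> L_pos by (intro mult_left_mono) auto
    also have "\<dots> = (?c * (L\<^sup>2 * \<eta>\<^sup>2) * (2 * (1 - \<beta>))) * (\<eta> / L * B1)
        + 2 * L * \<eta> ^ 3 * (?c * (1 - \<beta>)) * S"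
      using L_pos by (simp add: field_simps power2_eq_square power3_eq_cube)
    also have "\<dots> \<le> \<theta> * (\<eta> / L * B1) + 2 * L * \<eta> ^ 3 * (2 * (1 + \<kappa> - \<beta>)) * S"
    proof (intro add_mono mult_left_mono mult_right_mono)
      have "?c * (L\<^sup>2 * \<eta>\<^sup>2) * (2 * (1 - \<beta>)) \<le> (2 * (1 + \<kappa>)) * (L\<^sup>2 * \<eta>\<^sup>2) * (2 * \<theta>)"
        using \<beta> \<kappa> \<theta> by (intro mult_mono) auto
      also have "\<dots> = (4 * L\<^sup>2 * \<eta>\<^sup>2 * (1 + \<kappa>)) * \<theta>"
        by (simp add: algebra_simps)
      also have "\<dots> \<le> 1 * \<theta>"
        using \<eta> \<beta> \<theta> by (intro mult_right_mono) auto
      finally show "?c * (L\<^sup>2 * \<eta>\<^sup>2) * (2 * (1 - \<beta>)) \<le> \<theta>"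
        by simp
      have "?c * (1 - \<beta>) = \<theta> * (1 - \<beta>) + 2 * \<kappa> * (1 - \<beta>)"
        by (rule distrib_right)
      also have "\<dots> \<le> 1 * (1 - \<beta>) + 2 * \<kappa> * 1"
        using \<beta> \<kappa> \<theta> by (intro add_mono mult_mono) auto
      finally show "?c * (1 - \<beta>) \<le> 2 * (1 + \<kappa> - \<beta>)"
        using \<beta> by simp
    qed (use \<eta> L_pos nonneg in auto)
    finally show ?thesis by (simp add: algebra_simps)
  qed
  with main have "a * X1 + 2 * \<kappa> * \<eta> * L * A1
      \<le> X0 / (1 - \<beta>) + 4 * L * (1 + \<kappa> - \<beta>) * \<eta> ^ 3 * S"
    by (simp add: algebra_simps)
  then show ?thesis
    by (simp add: X0_def X1_def A1_def S_def a_def)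
qed

end

section \<open>Accumulated error over all epochs\<close>

lemma discounted_recursion:
  fixes a r e :: "nat \<Rightarrow> real"
  assumes "\<And>t. t \<in> {1..T} \<Longrightarrow> 0 < r t"
    and "\<And>t. t \<in> {1..T} \<Longrightarrow> r t * a t \<le> a (t - 1) + e t"
  shows "a T \<le> a 0 / (\<Prod>t=1..T. r t) + (\<Sum>j=1..T. e j / (\<Prod>t=j..T. r t))"
  using assms
proof (induction T)
  case (Suc T)
  let ?r = "r (Suc T)"
  have "0 < ?r" using Suc.prems(1) by simp
  have "?r * a (Suc T) \<le> a T + e (Suc T)"
    using Suc.prems(2)[of "Suc T"] by simp
  then have "a (Suc T) \<le> (a T + e (Suc T)) / ?r"
    using \<open>0 < ?r\<close> by (simp add: pos_le_divide_eq mult.commute)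
  also have "\<dots> \<le> (a 0 / (\<Prod>t=1..T. r t) + (\<Sum>j=1..T. e j / (\<Prod>t=j..T. r t)) + e (Suc T)) / ?r"
  proof (intro divide_right_mono add_right_mono)
    show "a T \<le> a 0 / (\<Prod>t=1..T. r t) + (\<Sum>j=1..T. e j / (\<Prod>t=j..T. r t))"
      using Suc by auto
  qed (use \<open>0 < ?r\<close> in simp)
  also have "\<dots> = a 0 / (\<Prod>t=1..Suc T. r t) + (\<Sum>j=1..Suc T. e j / (\<Prod>t=j..Suc T. r t))"
  proof -
    have "(\<Sum>j=1..T. e j / (\<Prod>t=j..T. r t)) / ?r = (\<Sum>j=1..T. e j / (\<Prod>t=j..Suc T. r t))"
      unfolding sum_divide_distrib by (intro sum.cong refl) simp
    then show ?thesis
      by (simp add: add_divide_distrib)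
  qed
  finally show ?case .
qed simp

text \<open>
  The sequence \<open>a\<close> in the proof is the Lyapunov function. Its reserve term has the divisor
  \<open>1 + \<mu> * \<eta> t\<close>, so that after contraction it equals what the one-epoch estimates set aside; the growth
  condition on \<open>\<eta>\<close> says that this covers the delayed loss in the next epoch. At \<open>t = 0\<close> it is the
  initial error inflated by \<open>1 / (1 - \<beta>)\<close>, as the first epoch demands.
\<close>

lemma (in strongly_convex_finite_sum) smg_error_bound:
  fixes \<beta> \<kappa> :: real and \<eta> :: "nat \<Rightarrow> real" and \<pi> :: "nat \<Rightarrow> nat \<Rightarrow> nat" and w0 :: 'a
  assumes perm: "\<And>t. t \<in> {1..T} \<Longrightarrow> \<pi> t permutes {1..n}"
    and \<beta>: "0 \<le> \<beta>" "\<beta> < 1" and \<kappa>: "0 \<le> \<kappa>"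
    and \<eta>_pos: "\<And>t. t \<in> {1..T} \<Longrightarrow> 0 < \<eta> t"
    and \<eta>_small: "\<And>t. t \<in> {1..T} \<Longrightarrow> 4 * L\<^sup>2 * (\<eta> t)\<^sup>2 * (1 + \<kappa>) \<le> 1"
    and \<eta>_growth: "\<And>t. t \<in> {2..T} \<Longrightarrow> \<beta> * \<eta> t * (1 + \<mu> * \<eta> (t - 1)) \<le> \<kappa> * \<eta> (t - 1)"
    and T: "T \<ge> 1"
  shows "(norm (fst (smg f n \<beta> \<eta> \<pi> w0 T) - wstar))\<^sup>2
    \<le> (norm (w0 - wstar))\<^sup>2 / ((1 - \<beta>) * (\<Prod>t=1..T. 1 + \<mu> * \<eta> t))
      + (\<Sum>j=1..T. 4 * L * (1 + \<kappa> - \<beta>) * \<eta> j ^ 3 * noise (\<pi> j) / (\<Prod>t=j..T. 1 + \<mu> * \<eta> t))"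
proof -
  define w m where "w t = fst (smg f n \<beta> \<eta> \<pi> w0 t)" and "m t = snd (smg f n \<beta> \<eta> \<pi> w0 t)" for t
  define u where "u t = (\<lambda>i. fst (smg_inner f n \<beta> (\<eta> t) (\<pi> t) (w (t - 1)) (m (t - 1)) i))" for t
  define e where "e t = 4 * L * (1 + \<kappa> - \<beta>) * \<eta> t ^ 3 * noise (\<pi> t)" for t
  define r where "r t = 1 + \<mu> * \<eta> t" for t
  define a where "a t = (if t = 0 then (norm (w0 - wstar))\<^sup>2 / (1 - \<beta>)
    else (norm (w t - wstar))\<^sup>2 + 2 * \<kappa> * \<eta> t * L * spread n (u t) / r t)" for t
  have w: "w t = u t n" and m: "m t = epoch_gradient f n (\<pi> t) (u t)" if "t \<in> {1..T}" for t
  proof -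
    from that obtain s where t: "t = Suc s"
      by (cases t) auto
    show "w t = u t n" and "m t = epoch_gradient f n (\<pi> t) (u t)"
      using smg_inner_final_step(1)[OF n_pos]
      by (simp_all add: w_def m_def u_def t Let_def split_beta)
  qed
  have r_pos: "0 < r t" if "t \<in> {1..T}" for t
    using \<eta>_pos[OF that] \<mu>_pos by (simp add: r_def add_pos_pos)
  have "r t * a t \<le> a (t - 1) + e t" if t: "t \<in> {1..T}" for t
  proof -
    have ra: "r t * a t = r t * (norm (u t n - wstar))\<^sup>2 + 2 * \<kappa> * \<eta> t * L * spread n (u t)"
      using t w[OF t] r_pos[OF t] by (simp add: a_def distrib_left)
    show ?thesis
    proof (cases "t = 1")
      case True
      have u1: "u t = (\<lambda>i. fst (smg_inner f n \<beta> (\<eta> t) (\<pi> t) w0 0 i))"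
        by (simp add: u_def w_def m_def True)
      have "r t * (norm (u t n - wstar))\<^sup>2 + 2 * \<kappa> * \<eta> t * L * spread n (u t)
          \<le> (norm (w0 - wstar))\<^sup>2 / (1 - \<beta>) + e t"
        unfolding u1 r_def e_def
        by (rule first_epoch) (use perm \<beta> \<kappa> \<eta>_pos \<eta>_small t in auto)
      then show ?thesis
        using ra True by (simp add: a_def)
    next
      case False
      define s where "s = t - 1"
      have s: "s \<in> {1..T}" and "t \<in> {2..T}"
        using t False by (auto simp: s_def)
      have ut: "u t = (\<lambda>i. fst (smg_inner f n \<beta> (\<eta> t) (\<pi> t) (w s) (m s) i))"
        by (simp add: u_def s_def)
      have "r t * (norm (u t n - wstar))\<^sup>2 + 2 * \<kappa> * \<eta> t * L * spread n (u t)
          \<le> (norm (w s - wstar))\<^sup>2 + 2 * \<beta> * \<eta> t * L * spread n (u s) + e t"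
        unfolding ut r_def e_def
        by (rule later_epoch[OF _ _ w[OF s] m[OF s]]) (use perm \<beta> \<kappa> \<eta>_pos \<eta>_small s t in auto)
      moreover have "2 * \<beta> * \<eta> t * L * spread n (u s) \<le> 2 * \<kappa> * \<eta> s * L * spread n (u s) / r s"
      proof -
        have "\<beta> * \<eta> t \<le> \<kappa> * \<eta> s / r s"
          using \<eta>_growth[OF \<open>t \<in> {2..T}\<close>] r_pos[OF s] by (simp add: pos_le_divide_eq r_def s_def)
        then have "\<beta> * \<eta> t * (2 * L * spread n (u s)) \<le> \<kappa> * \<eta> s / r s * (2 * L * spread n (u s))"
          using L_pos spread_nonneg[of n "u s"] by (intro mult_right_mono) auto
        then show ?thesis
          by (simp add: mult_ac)
      qed
      moreover have "a s = (norm (w s - wstar))\<^sup>2 + 2 * \<kappa> * \<eta> s * L * spread n (u s) / r s"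
        using s by (simp add: a_def)
      ultimately show ?thesis
        using ra unfolding s_def by linarith
    qed
  qed
  then have "a T \<le> a 0 / (\<Prod>t=1..T. r t) + (\<Sum>j=1..T. e j / (\<Prod>t=j..T. r t))"
    by (intro discounted_recursion r_pos)
  moreover have "(norm (w T - wstar))\<^sup>2 \<le> a T"
    using T \<kappa> L_pos \<eta>_pos[of T] r_pos[of T] spread_nonneg[of n "u T"] by (simp add: a_def)
  ultimately show ?thesis
    by (simp add: w_def a_def e_def r_def)
qed

section \<open>Expectation over the permutations\<close>

text \<open>
  The variance formula makes the mean equal to \<open>(n + 1) / (6 * n\<^sup>2)\<close> times the mean squared gradient
  norm when \<open>n \<ge> 2\<close>, and \<open>n + 1 \<le> 2 * n\<close>. A single component has zero gradient at \<open>z\<close>, so there is no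
  noise when \<open>n = 1\<close>, where the variance formula is void.
\<close>

lemma mean_shuffling_noise_le:
  fixes f :: "nat \<Rightarrow> 'a::real_inner \<Rightarrow> real"
  assumes n: "n \<ge> 1" and centered: "(\<Sum>i=1..n. grad (f i) z) = 0"
  shows "(\<Sum>p | p permutes {1..n}. shuffling_noise f n z p) / fact n
    \<le> (1 / real n * (\<Sum>i=1..n. (norm (grad (f i) z))\<^sup>2)) / (3 * real n)"
proof (cases "n = 1")
  case True
  have "shuffling_noise f n z p = 0" if "p permutes {1..n}" for p
    using sum_shuffled[OF that, of "\<lambda>i. grad (f i) z"] centered True
    by (simp add: shuffling_noise_def)
  then show ?thesis
    by (simp add: sum_nonneg)
next
  case False
  define V where "V = (\<Sum>i=1..n. (norm (grad (f i) z))\<^sup>2)"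
  define Q where "Q i = (\<Sum>p | p permutes {1..n}. (norm (\<Sum>j=i..<n. grad (f (p (j + 1))) z))\<^sup>2)" for i
  have "V \<ge> 0" by (simp add: V_def sum_nonneg)
  have n2: "real n \<ge> 2" using n False by simp
  have Q: "real n * (real n - 1) * Q i = (real n - real i) * real i * (fact n * V)" if "i < n" for i
  proof -
    have "(\<Sum>j=i..<n. grad (f (p (j + 1))) z) = (\<Sum>a\<in>{Suc i..n}. grad (f (p a)) z)" for p
      using sum.shift_bounds_Suc_ivl[of "\<lambda>a. grad (f (p a)) z" i n]
      by (simp add: atLeastLessThanSuc_atLeastAtMost)
    moreover have "real (card {Suc i..n}) = real n - real i"
      using that by (simp add: of_nat_diff)
    ultimately show ?thesis
      using sum_permutations_norm_partial_sum[of "{1..n}" "{Suc i..n}" "\<lambda>i. grad (f i) z"] centered that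
      by (simp add: Q_def V_def mult_ac)
  qed
  have "real n * (real n - 1) * (\<Sum>i<n. Q i) = (\<Sum>i<n. (real n - real i) * real i) * (fact n * V)"
    by (simp add: sum_distrib_left sum_distrib_right Q)
  also have "\<dots> = real n * (real n - 1) * ((real n + 1) * (fact n * V) / 6)"
    unfolding sum_diff_mult_index by (simp add: power2_eq_square algebra_simps)
  finally have Q_sum: "(\<Sum>i<n. Q i) = (real n + 1) * (fact n * V) / 6"
    using n2 by simp
  have "(\<Sum>p | p permutes {1..n}. shuffling_noise f n z p) / fact n
      = (\<Sum>i<n. Q i) / real n ^ 3 / fact n"
    unfolding shuffling_noise_def Q_def by (subst sum.swap) (simp flip: sum_divide_distrib)
  also have "\<dots> = (real n + 1) * V / (6 * real n ^ 3)"
    by (simp add: Q_sum)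
  also have "\<dots> \<le> (2 * real n) * V / (6 * real n ^ 3)"
    using n2 \<open>V \<ge> 0\<close> by (intro divide_right_mono mult_right_mono) auto
  also have "\<dots> = (1 / real n * V) / (3 * real n)"
    using n2 by (simp add: power3_eq_cube)
  finally show ?thesis
    by (simp add: V_def)
qed

lemma (in prob_space) reshuffling_AE_permutes:
  assumes "randomized_reshuffling n T \<pi> W0"
  shows "AE \<omega> in M. \<forall>t\<in>{1..T}. \<pi> t \<omega> permutes {1..n}"
proof (intro AE_finite_allI)
  fix t assume t: "t \<in> {1..T}"
  then have rv: "\<pi> t \<in> measurable M (count_space UNIV)"
    and distr: "distr M (count_space UNIV) (\<pi> t) = measure_pmf (pmf_of_set {p. p permutes {1..n}})"
    using assms by (auto simp: randomized_reshuffling_def)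
  have "{p. p permutes {1..n}} \<noteq> {}"
    using permutes_id[of "{1..n}"] by blast
  then have "AE p in measure_pmf (pmf_of_set {p. p permutes {1..n}}). p permutes {1..n}"
    by (simp add: AE_measure_pmf_iff set_pmf_of_set finite_permutations)
  then show "AE \<omega> in M. \<pi> t \<omega> permutes {1..n}"
    unfolding distr[symmetric] by (subst (asm) AE_distr_iff[OF rv]) auto
qed simp

lemma (in prob_space) reshuffling_expected_noise_le:
  fixes f :: "nat \<Rightarrow> 'b::real_inner \<Rightarrow> real"
  assumes "randomized_reshuffling n T \<pi> W0" and t: "t \<in> {1..T}"
    and n: "n \<ge> 1" and centered: "(\<Sum>i=1..n. grad (f i) z) = 0"
  shows "(\<integral>\<^sup>+\<omega>. ennreal (shuffling_noise f n z (\<pi> t \<omega>)) \<partial>M)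
    \<le> ennreal ((1 / real n * (\<Sum>i=1..n. (norm (grad (f i) z))\<^sup>2)) / (3 * real n))"
proof -
  let ?P = "{p. p permutes {1..n}}"
  have rv: "\<pi> t \<in> measurable M (count_space UNIV)"
    and distr: "distr M (count_space UNIV) (\<pi> t) = measure_pmf (pmf_of_set ?P)"
    using assms by (auto simp: randomized_reshuffling_def)
  have P: "finite ?P" "?P \<noteq> {}"
    using finite_permutations[of "{1..n}"] permutes_id[of "{1..n}"] by blast+
  have "(\<integral>\<^sup>+\<omega>. ennreal (shuffling_noise f n z (\<pi> t \<omega>)) \<partial>M)
      = (\<integral>\<^sup>+p. ennreal (shuffling_noise f n z p) \<partial>distr M (count_space UNIV) (\<pi> t))"
    by (rule nn_integral_distr[OF rv, symmetric]) simp
  also have "\<dots> = (\<Sum>p\<in>?P. ennreal (shuffling_noise f n z p)) / of_nat (card ?P)"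
    unfolding distr by (rule nn_integral_pmf_of_set[OF P(2,1)])
  also have "\<dots> = ennreal ((\<Sum>p\<in>?P. shuffling_noise f n z p) / fact n)"
  proof -
    have "(of_nat (card ?P) :: ennreal) = ennreal (fact n)"
      by (simp add: card_permutations ennreal_of_nat_eq_real_of_nat)
    then show ?thesis
      by (simp add: shuffling_noise_nonneg sum_nonneg divide_ennreal)
  qed
  also have "\<dots> \<le> ennreal ((1 / real n * (\<Sum>i=1..n. (norm (grad (f i) z))\<^sup>2)) / (3 * real n))"
    by (intro ennreal_leI mean_shuffling_noise_le n centered)
  finally show ?thesis .
qed

section \<open>Convergence in expectation\<close>

text \<open>
  The stochastic bound follows by integrating \<open>smg_error_bound\<close> term by term. Its right-hand side
  depends on the sample only through \<open>W0\<close> and the permutations and is therefore measurable. The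
  integrals are taken in the extended nonnegative reals, where the mean initial error may be infinite.
\<close>

theorem theorem2:
  fixes f :: "nat \<Rightarrow> real ^ 'd \<Rightarrow> real"
    and F :: "real ^ 'd \<Rightarrow> real"
    and wstar :: "real ^ 'd"
    and M :: "'s measure"
    and W0 :: "'s \<Rightarrow> real ^ 'd"
    and \<pi> :: "nat \<Rightarrow> 's \<Rightarrow> nat \<Rightarrow> nat"
    and \<eta> :: "nat \<Rightarrow> real"
    and L \<mu> \<alpha> \<beta> K \<sigma>sq :: real
    and n T :: nat
  assumes "n \<ge> 1" and "T \<ge> 1"
    and "L > 0" and "\<mu> > 0" and "0 \<le> \<beta>" and "\<beta> < 1" and "\<alpha> > 0"
    and "\<And>i. i \<in> {1..n} \<Longrightarrow> convex_on UNIV (f i)"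
    and "\<And>i. i \<in> {1..n} \<Longrightarrow> L_smooth L (f i)"
    and "F = (\<lambda>w. 1 / real n * (\<Sum>i=1..n. f i w))"
    and "strongly_convex \<mu> F"
    and "is_arg_min F (\<lambda>_. True) wstar"
    and "\<sigma>sq = 1 / real n * (\<Sum>i=1..n. (norm (grad (f i) wstar))\<^sup>2)"
    and "prob_space M"
    and "prob_space.randomized_reshuffling M n T \<pi> W0"
    and "\<And>t. t \<in> {2..T} \<Longrightarrow> \<eta> t \<le> \<alpha> * \<eta> (t - 1)"
    and "K = 1 + \<alpha> * \<beta> * (1 + \<mu> * Max (\<eta> ` {1..T}))"
    and "\<And>t. t \<in> {1..T} \<Longrightarrow> 0 < \<eta> t \<and> \<eta> t \<le> 1 / (2 * L * sqrt K)"
  shows "(\<integral>\<^sup>+\<omega>. ennreal ((norm (fst (smg f n \<beta> \<eta> (\<lambda>t. \<pi> t \<omega>) (W0 \<omega>) T) - wstar))\<^sup>2) \<partial>M)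
       \<le> (\<integral>\<^sup>+\<omega>. ennreal ((norm (W0 \<omega> - wstar))\<^sup>2) \<partial>M)
            / ennreal ((1 - \<beta>) * (\<Prod>t=1..T. 1 + \<mu> * \<eta> t))
         + ennreal (4 * L * \<sigma>sq / (3 * real n)
             * (\<Sum>j=1..T. (\<eta> j) ^ 3 * ((K - \<beta>) / (\<Prod>t=j..T. 1 + \<mu> * \<eta> t))))"
proof -
  interpret prob_space M by fact
  note \<eta> = assms(18)
  have GF: "GDERIV F w :> (1 / real n) *\<^sub>R (\<Sum>i=1..n. grad (f i) w)" for w
    unfolding \<open>F = _\<close> using assms(9) by (intro GDERIV_scaled_sum GDERIV_grad) (auto simp: L_smooth_def)
  then have "F differentiable (at wstar)"
    unfolding gderiv_def differentiable_def by blast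
  then have grad_F: "grad F wstar = 0"
    by (intro gradient_at_minimizer_eq_0[OF assms(12)] GDERIV_grad)
  have centered: "(\<Sum>i=1..n. grad (f i) wstar) = 0"
    using gradient_at_minimizer_eq_0[OF assms(12) GF] \<open>n \<ge> 1\<close> by simp
  interpret strongly_convex_finite_sum f n L \<mu> wstar
  proof
    fix y
    have "F wstar + \<mu> / 2 * (norm (y - wstar))\<^sup>2 \<le> F y"
      using assms(11) grad_F unfolding strongly_convex_def by (metis add_0_right inner_zero_left)
    then have "real n * (\<mu> / 2 * (norm (y - wstar))\<^sup>2) \<le> real n * (F y - F wstar)"
      by (intro mult_left_mono) auto
    also have "\<dots> = (\<Sum>i=1..n. f i y - f i wstar)"
      using \<open>n \<ge> 1\<close> unfolding \<open>F = _\<close> by (simp add: sum_subtractf right_diff_distrib)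
    finally show "real n * (\<mu> / 2 * (norm (y - wstar))\<^sup>2) \<le> (\<Sum>i=1..n. f i y - f i wstar)" .
  qed (use assms centered in auto)

  define \<kappa> where "\<kappa> = \<alpha> * \<beta> * (1 + \<mu> * Max (\<eta> ` {1..T}))"
  have \<eta>_le_Max: "\<eta> t \<le> Max (\<eta> ` {1..T})" if "t \<in> {1..T}" for t
    using that by (intro Max_ge) auto
  have "0 < Max (\<eta> ` {1..T})"
    using \<eta>[of 1] \<open>T \<ge> 1\<close> by (intro less_le_trans[OF _ \<eta>_le_Max[of 1]]) auto
  then have \<kappa>: "0 \<le> \<kappa>" and K: "K = 1 + \<kappa>"
    using assms by (simp_all add: \<kappa>_def)
  have \<eta>_small: "4 * L\<^sup>2 * (\<eta> t)\<^sup>2 * (1 + \<kappa>) \<le> 1" if "t \<in> {1..T}" for t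
  proof -
    have "\<eta> t * (2 * L * sqrt K) \<le> 1"
      using \<eta>[OF that] \<kappa> K L_pos by (simp add: pos_le_divide_eq)
    then have "(\<eta> t * (2 * L * sqrt K))\<^sup>2 \<le> 1"
      using \<eta>[OF that] \<kappa> K L_pos by (intro power_le_one) (auto intro!: mult_nonneg_nonneg)
    then show ?thesis
      using \<kappa> K by (simp add: power_mult_distrib algebra_simps)
  qed
  \<comment> \<open>The constant \<open>K\<close> is chosen for this inequality.\<close>
  have \<eta>_growth: "\<beta> * \<eta> t * (1 + \<mu> * \<eta> (t - 1)) \<le> \<kappa> * \<eta> (t - 1)" if t: "t \<in> {2..T}" for t
  proof -
    have t1: "t - 1 \<in> {1..T}" using t by auto
    have "\<beta> * \<eta> t * (1 + \<mu> * \<eta> (t - 1))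
        \<le> \<beta> * (\<alpha> * \<eta> (t - 1)) * (1 + \<mu> * Max (\<eta> ` {1..T}))"
      using assms(16)[OF t] \<eta>_le_Max[OF t1] \<eta>[OF t1] assms
      by (intro mult_mono add_mono mult_left_mono) auto
    then show ?thesis
      by (simp add: \<kappa>_def mult_ac)
  qed

  define P where "P j = (\<Prod>t=j..T. 1 + \<mu> * \<eta> t)" for j
  have P_pos: "0 < P j" if "j \<ge> 1" for j
    unfolding P_def using that \<eta> \<open>\<mu> > 0\<close> by (intro prod_pos) (auto intro!: add_pos_pos)
  define c where "c j = 4 * L * (K - \<beta>) * \<eta> j ^ 3 / P j" for j
  have c_nonneg: "0 \<le> c j" if "j \<in> {1..T}" for j
    using that \<eta>[of j] P_pos[of j] \<kappa> K \<open>\<beta> < 1\<close> L_pos by (simp add: c_def)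
  have \<sigma>: "0 \<le> \<sigma>sq" unfolding assms(13) by (simp add: sum_nonneg)
  have W0: "W0 \<in> borel_measurable M"
    and \<pi>: "\<And>t. t \<in> {1..T} \<Longrightarrow> \<pi> t \<in> measurable M (count_space UNIV)"
    using assms(15) by (auto simp: randomized_reshuffling_def)
  have noise_measurable: "(\<lambda>\<omega>. ennreal (noise (\<pi> t \<omega>))) \<in> borel_measurable M" if "t \<in> {1..T}" for t
    using measurable_compose[OF \<pi>[OF that], of "\<lambda>p. ennreal (noise p)" borel] by simp
  have W0_measurable: "(\<lambda>\<omega>. ennreal ((norm (W0 \<omega> - wstar))\<^sup>2)) \<in> borel_measurable M"
    using W0 by measurable

  have "AE \<omega> in M. ennreal ((norm (fst (smg f n \<beta> \<eta> (\<lambda>t. \<pi> t \<omega>) (W0 \<omega>) T) - wstar))\<^sup>2)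
      \<le> ennreal ((norm (W0 \<omega> - wstar))\<^sup>2) / ennreal ((1 - \<beta>) * P 1)
        + (\<Sum>j=1..T. ennreal (c j) * ennreal (noise (\<pi> j \<omega>)))"
    using reshuffling_AE_permutes[OF assms(15)]
  proof eventually_elim
    case (elim \<omega>)
    have "(norm (fst (smg f n \<beta> \<eta> (\<lambda>t. \<pi> t \<omega>) (W0 \<omega>) T) - wstar))\<^sup>2
        \<le> (norm (W0 \<omega> - wstar))\<^sup>2 / ((1 - \<beta>) * P 1) + (\<Sum>j=1..T. c j * noise (\<pi> j \<omega>))"
      using smg_error_bound[of T "\<lambda>t. \<pi> t \<omega>" \<beta> \<kappa> \<eta> "W0 \<omega>"] elim assms(2,5,6) \<kappa> \<eta> \<eta>_small \<eta>_growth
      by (simp add: P_def c_def K)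
    then have "ennreal ((norm (fst (smg f n \<beta> \<eta> (\<lambda>t. \<pi> t \<omega>) (W0 \<omega>) T) - wstar))\<^sup>2)
        \<le> ennreal ((norm (W0 \<omega> - wstar))\<^sup>2 / ((1 - \<beta>) * P 1) + (\<Sum>j=1..T. c j * noise (\<pi> j \<omega>)))"
      by (rule ennreal_leI)
    also have "\<dots> = ennreal ((norm (W0 \<omega> - wstar))\<^sup>2) / ennreal ((1 - \<beta>) * P 1)
        + (\<Sum>j=1..T. ennreal (c j) * ennreal (noise (\<pi> j \<omega>)))"
    proof -
      have "ennreal (\<Sum>j=1..T. c j * noise (\<pi> j \<omega>)) = (\<Sum>j=1..T. ennreal (c j) * ennreal (noise (\<pi> j \<omega>)))"
        using c_nonneg by (subst sum_ennreal[symmetric]) (auto simp: shuffling_noise_nonneg ennreal_mult)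
      moreover have "0 \<le> (\<Sum>j=1..T. c j * noise (\<pi> j \<omega>))"
        using c_nonneg by (intro sum_nonneg) (auto simp: shuffling_noise_nonneg)
      ultimately show ?thesis
        using P_pos[of 1] \<open>\<beta> < 1\<close> by (simp add: divide_ennreal ennreal_plus)
    qed
    finally show ?case .
  qed
  then have "(\<integral>\<^sup>+\<omega>. ennreal ((norm (fst (smg f n \<beta> \<eta> (\<lambda>t. \<pi> t \<omega>) (W0 \<omega>) T) - wstar))\<^sup>2) \<partial>M)
      \<le> (\<integral>\<^sup>+\<omega>. ennreal ((norm (W0 \<omega> - wstar))\<^sup>2) / ennreal ((1 - \<beta>) * P 1)
        + (\<Sum>j=1..T. ennreal (c j) * ennreal (noise (\<pi> j \<omega>))) \<partial>M)"
    by (rule nn_integral_mono_AE)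
  also have "\<dots> = (\<integral>\<^sup>+\<omega>. ennreal ((norm (W0 \<omega> - wstar))\<^sup>2) \<partial>M) / ennreal ((1 - \<beta>) * P 1)
      + (\<Sum>j=1..T. ennreal (c j) * (\<integral>\<^sup>+\<omega>. ennreal (noise (\<pi> j \<omega>)) \<partial>M))"
  proof -
    have "(\<integral>\<^sup>+\<omega>. (\<Sum>j=1..T. ennreal (c j) * ennreal (noise (\<pi> j \<omega>))) \<partial>M)
        = (\<Sum>j=1..T. \<integral>\<^sup>+\<omega>. ennreal (c j) * ennreal (noise (\<pi> j \<omega>)) \<partial>M)"
      by (rule nn_integral_sum) (intro borel_measurable_times_ennreal noise_measurable, simp_all)
    also have "\<dots> = (\<Sum>j=1..T. ennreal (c j) * (\<integral>\<^sup>+\<omega>. ennreal (noise (\<pi> j \<omega>)) \<partial>M))"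
      by (intro sum.cong refl nn_integral_cmult noise_measurable)
    finally show ?thesis
      using noise_measurable W0_measurable
      by (subst nn_integral_add)
        (auto simp: nn_integral_divide intro!: borel_measurable_sum borel_measurable_times_ennreal)
  qed
  also have "\<dots> \<le> (\<integral>\<^sup>+\<omega>. ennreal ((norm (W0 \<omega> - wstar))\<^sup>2) \<partial>M) / ennreal ((1 - \<beta>) * P 1)
      + (\<Sum>j=1..T. ennreal (c j) * ennreal (\<sigma>sq / (3 * real n)))"
    using reshuffling_expected_noise_le[OF assms(15) _ \<open>n \<ge> 1\<close> centered]
    by (intro add_left_mono sum_mono mult_left_mono) (auto simp: assms(13))
  also have "(\<Sum>j=1..T. ennreal (c j) * ennreal (\<sigma>sq / (3 * real n)))
      = ennreal (\<Sum>j=1..T. c j * (\<sigma>sq / (3 * real n)))"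
  proof -
    have "ennreal (c j) * ennreal (\<sigma>sq / (3 * real n)) = ennreal (c j * (\<sigma>sq / (3 * real n)))"
      if "j \<in> {1..T}" for j
      using c_nonneg[OF that] \<sigma> by (intro ennreal_mult[symmetric]) auto
    then show ?thesis
      using c_nonneg \<sigma> by (subst sum_ennreal[symmetric]) (auto intro!: mult_nonneg_nonneg)
  qed
  also have "(\<Sum>j=1..T. c j * (\<sigma>sq / (3 * real n)))
      = 4 * L * \<sigma>sq / (3 * real n) * (\<Sum>j=1..T. (\<eta> j) ^ 3 * ((K - \<beta>) / P j))"
    unfolding sum_distrib_left by (intro sum.cong refl) (simp add: c_def mult_ac)
  finally show ?thesis
    by (simp add: P_def)
qed

end
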